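(* Let $V$ be a finite set and fix $(K,\omega,\mu)$ and $\mathrm{BN}^{\mathrm{eqb}}$ as in the context. Conditional independence is consistently testable in the set of observational distributions induced by $\mathrm{BN}^{\mathrm{eqb}}$. That is, let $\mathcal P=\{D(m):(G,m)\in\mathrm{BN}^{\mathrm{eqb}}\}$, let $A,B,C\subseteq V$, and let $H_0=\{\mathbb P\in\mathcal P:X_A\perp\!\!\!\perp_{\mathbb P}X_B\mid X_C\}$ and $H_1=\mathcal P\setminus H_0$; then there exist measurable maps $\varphi_n:\mathcal X_V^n\to\{0,1\}$ ($n\in\mathbb N$) such that for every $\mathbb P\in\mathcal P$ and $i\in\{0,1\}$, $\lim_{n\to\infty}\mathbb P^n(\varphi_n=i)=1$ if and only if $\mathbb P\in H_i$.
   Context: For each $v\in V$, $\mathcal X_v$ is a separable complete metric space with at least two points and its Borel $\sigma$-algebra; $\mathcal X_A=\prod_{v\in A}\mathcal X_v$ carries the Euclidean product metric $d(x,x')=(\sum_{v\in A}d_v(x_v,x_v')^2)^{1/2}$. $X_A$ denotes the coordinate projection to $\mathcal X_A$. $X_A\perp\!\!\!\perp_{\mathbb P}X_B\mid X_C$ means $\mathbb P(X_A\in E_A,X_B\in E_B\mid X_C)=\mathbb P(X_A\in E_A\mid X_C)\mathbb P(X_B\in E_B\mid X_C)$ a.s. for all Borel $E_A,E_B$. $\mathbb P^n$ is the $n$-fold product measure. For a DAG $G$ with vertices $V$ (a finite directed graph without directed cycles) and $\mathrm{pa}_G(v)=\{w:w\to v\text{ in }G\}$, a Bayesian network with graph $G$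 is a tuple $m=(\mathbb P(X_v\mid X_{\mathrm{pa}_G(v)}))_{v\in V}$ of Markov kernels $\mathcal X_{\mathrm{pa}_G(v)}\to\mathcal P(\mathcal X_v)$, and $D(m)=\bigotimes_v\mathbb P(X_v\mid X_{\mathrm{pa}_G(v)})$ is its observational distribution on $\mathcal X_V$. A modulus of continuity is a nonzero concave function $\omega:[0,\infty)\to[0,\infty)$ with $\lim_{t\downarrow0}\omega(t)=\omega(0)=0$; $f$ admits $\omega$ if $|f(x)-f(x')|\le\omega(d(x,x'))$ for all $x,x'$. Fix $K>0$, a modulus $\omega$ and locally finite measures $\mu_v$ on $\mathcal X_v$ with $\mu=\bigotimes_v\mu_v$. $\mathrm{BN}_G^{\mathrm{eqb}}$ is the set of Bayesian networks with graph $G$ such that for each $v$ the kernel has a conditional density $(x_v,x_{\mathrm{pa}_G(v)})\mapsto p(x_v\mid x_{\mathrm{pa}_G(v)})$ with respect to $\mu_v$ that is bounded by $K$ and admits the modulus $\omega$ on $\mathcal X_v\times\mathcal X_{\mathrm{pa}_G(v)}$. $\mathrm{BN}^{\mathrm{eqb}}=\bigcup_G\{G\}\times\mathrm{BN}_G^{\mathrm{eqb}}$, the union over all DAGs $G$ with vertices $V$. *)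

theory Defs
  imports "HOL-Probability.Probability"
begin

section \<open>Products of metric spaces\<close>

text \<open>
  The spaces are a family \<open>X :: 'v \<Rightarrow> 'a metric\<close>. The carrier \<open>mspace (X v)\<close> may vary with \<open>v\<close>;
  the common type \<open>'a\<close> is only an ambient type. Points of the product over \<open>A\<close> are extensional
  functions on \<open>A\<close>. Since the factors are separable, the product sigma-algebra used in
  \<open>prod_space\<close> is the Borel sigma-algebra of \<open>prod_mdist\<close>.
\<close>

definition borel_of_metric :: "'a metric \<Rightarrow> 'a measure" where
  "borel_of_metric m = sigma (mspace m) {U. openin (mtopology_of m) U}"

definition prod_space :: "('v \<Rightarrow> 'a metric) \<Rightarrow> 'v set \<Rightarrow> ('v \<Rightarrow> 'a) measure" where
  "prod_space X A = PiM A (\<lambda>v. borel_of_metric (X v))"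

definition prod_mdist :: "('v \<Rightarrow> 'a metric) \<Rightarrow> 'v set \<Rightarrow> ('v \<Rightarrow> 'a) \<Rightarrow> ('v \<Rightarrow> 'a) \<Rightarrow> real" where
  "prod_mdist X A x x' = sqrt (\<Sum>v\<in>A. (mdist (X v) (x v) (x' v))\<^sup>2)"

definition locally_finite_on :: "'a metric \<Rightarrow> 'a measure \<Rightarrow> bool" where
  "locally_finite_on m M \<longleftrightarrow> sets M = sets (borel_of_metric m) \<and>
     (\<forall>x\<in>mspace m. \<exists>U. openin (mtopology_of m) U \<and> x \<in> U \<and> emeasure M U < \<infinity>)"


section \<open>Moduli of continuity\<close>

definition modulus_of_continuity :: "(real \<Rightarrow> real) \<Rightarrow> bool" where
  "modulus_of_continuity \<omega> \<longleftrightarrow>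
     (\<forall>t\<ge>0. \<omega> t \<ge> 0) \<and> (\<exists>t\<ge>0. \<omega> t \<noteq> 0) \<and> concave_on {0..} \<omega> \<and>
     \<omega> 0 = 0 \<and> (\<omega> \<longlongrightarrow> 0) (at_right 0)"

definition admits_modulus ::
  "'b set \<Rightarrow> ('b \<Rightarrow> 'b \<Rightarrow> real) \<Rightarrow> (real \<Rightarrow> real) \<Rightarrow> ('b \<Rightarrow> real) \<Rightarrow> bool" where
  "admits_modulus S d \<omega> f \<longleftrightarrow> (\<forall>x\<in>S. \<forall>x'\<in>S. \<bar>f x - f x'\<bar> \<le> \<omega> (d x x'))"


section \<open>Conditional independence\<close>

text \<open>Conditioning on \<open>X\<^sub>C\<close> is conditioning on the sigma-algebra that it generates.\<close>

definition sigma_of_proj ::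
  "('v \<Rightarrow> 'a metric) \<Rightarrow> 'v set \<Rightarrow> 'v set \<Rightarrow> ('v \<Rightarrow> 'a) measure" where
  "sigma_of_proj X V C =
     vimage_algebra (space (prod_space X V)) (\<lambda>x. restrict x C) (prod_space X C)"

definition cond_prob ::
  "('v \<Rightarrow> 'a metric) \<Rightarrow> 'v set \<Rightarrow> ('v \<Rightarrow> 'a) measure \<Rightarrow> 'v set \<Rightarrow> ('v \<Rightarrow> 'a) set \<Rightarrow> ('v \<Rightarrow> 'a) \<Rightarrow> real" where
  "cond_prob X V P C S = real_cond_exp P (sigma_of_proj X V C) (indicator S)"

definition cond_indep ::
  "('v \<Rightarrow> 'a metric) \<Rightarrow> 'v set \<Rightarrow> ('v \<Rightarrow> 'a) measure \<Rightarrow> 'v set \<Rightarrow> 'v set \<Rightarrow> 'v set \<Rightarrow> bool" where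
  "cond_indep X V P A B C \<longleftrightarrow>
     (\<forall>EA \<in> sets (prod_space X A). \<forall>EB \<in> sets (prod_space X B).
        AE x in P.
          cond_prob X V P C {y \<in> space P. restrict y A \<in> EA \<and> restrict y B \<in> EB} x =
          cond_prob X V P C {y \<in> space P. restrict y A \<in> EA} x *
          cond_prob X V P C {y \<in> space P. restrict y B \<in> EB} x)"


section \<open>Bayesian networks\<close>

text \<open>An edge \<open>w \<rightarrow> v\<close> of a graph \<open>G\<close> is the pair \<open>(w, v) \<in> G\<close>.\<close>

definition dag :: "'v set \<Rightarrow> 'v rel \<Rightarrow> bool" where
  "dag V G \<longleftrightarrow> G \<subseteq> V \<times> V \<and> acyclic G"

definition parents :: "'v rel \<Rightarrow> 'v \<Rightarrow> 'v set" where
  "parents G v = {w. (w, v) \<in> G}"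

definition bayesian_network ::
  "('v \<Rightarrow> 'a metric) \<Rightarrow> 'v set \<Rightarrow> 'v rel \<Rightarrow> ('v \<Rightarrow> ('v \<Rightarrow> 'a) \<Rightarrow> 'a measure) \<Rightarrow> bool" where
  "bayesian_network X V G m \<longleftrightarrow>
     (\<forall>v\<in>V. m v \<in> prod_space X (parents G v) \<rightarrow>\<^sub>M prob_algebra (borel_of_metric (X v)))"

text \<open>
  The product of the kernels is their successive composition along a topological order of the
  graph. In \<open>kernel_product\<close> the list is in reverse order: the head is the vertex
  whose kernel is appended last.
\<close>

definition topological_order :: "'v set \<Rightarrow> 'v rel \<Rightarrow> 'v list \<Rightarrow> bool" where
  "topological_order V G vs \<longleftrightarrow>
     distinct vs \<and> set vs = V \<and> sorted_wrt (\<lambda>v w. (w, v) \<notin> G) vs"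

primrec kernel_product ::
  "('v \<Rightarrow> 'a metric) \<Rightarrow> 'v rel \<Rightarrow> ('v \<Rightarrow> ('v \<Rightarrow> 'a) \<Rightarrow> 'a measure) \<Rightarrow> 'v list \<Rightarrow> ('v \<Rightarrow> 'a) measure" where
  "kernel_product X G m [] = return (prod_space X {}) (\<lambda>_. undefined)"
| "kernel_product X G m (v # vs) =
     kernel_product X G m vs \<bind>
       (\<lambda>x. distr (m v (restrict x (parents G v))) (prod_space X (insert v (set vs))) (\<lambda>a. x(v := a)))"

text \<open>Any two topological orders give the same measure, so the choice made here is immaterial.\<close>

definition obs_dist ::
  "('v \<Rightarrow> 'a metric) \<Rightarrow> 'v set \<Rightarrow> 'v rel \<Rightarrow> ('v \<Rightarrow> ('v \<Rightarrow> 'a) \<Rightarrow> 'a measure) \<Rightarrow> ('v \<Rightarrow> 'a) measure" where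
  "obs_dist X V G m = kernel_product X G m (rev (SOME vs. topological_order V G vs))"

lemma topological_order_exists:
  assumes "finite V" and "dag V G"
  shows "\<exists>vs. topological_order V G vs"
proof -
  have "\<exists>vs. topological_order U G vs" if "finite U" for U
    using that
  proof (induction U rule: finite_psubset_induct)
    case (psubset U)
    show ?case
    proof (cases "U = {}")
      case True
      then show ?thesis by (intro exI[of _ "[]"]) (simp add: topological_order_def)
    next
      case False
      have "finite (G \<inter> U \<times> U)" using psubset.hyps by simp
      moreover have "acyclic (G \<inter> U \<times> U)"
        using assms(2) acyclic_subset[of G "G \<inter> U \<times> U"] by (simp add: dag_def)
      ultimately have "wf ((G \<inter> U \<times> U)\<inverse>)" by (rule finite_acyclic_wf_converse)
      moreover obtain u where "u \<in> U" using False by blast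
      ultimately obtain z where "z \<in> U" and
        min: "\<And>y. (y, z) \<in> (G \<inter> U \<times> U)\<inverse> \<Longrightarrow> y \<notin> U"
        by (rule wfE_min) blast
      then have z: "z \<in> U" "\<And>y. (z, y) \<in> G \<Longrightarrow> y \<notin> U"
        by blast+
      from z(1) have "U - {z} \<subset> U" by auto
      with psubset.IH obtain vs where "topological_order (U - {z}) G vs" by blast
      then have "topological_order U G (vs @ [z])"
        using z by (auto simp: topological_order_def sorted_wrt_append)
      then show ?thesis ..
    qed
  qed
  then show ?thesis using assms(1) by blast
qed


section \<open>Equicontinuous bounded Bayesian networks\<close>

definition cond_density ::
  "('v \<Rightarrow> 'a metric) \<Rightarrow> ('v \<Rightarrow> 'a measure) \<Rightarrow> 'v rel \<Rightarrow> 'v \<Rightarrow> (('v \<Rightarrow> 'a) \<Rightarrow> 'a measure) \<Rightarrow>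
     ('a \<times> ('v \<Rightarrow> 'a) \<Rightarrow> real) \<Rightarrow> bool" where
  "cond_density X \<mu> G v k p \<longleftrightarrow>
     p \<in> borel_measurable (borel_of_metric (X v) \<Otimes>\<^sub>M prod_space X (parents G v)) \<and>
     (\<forall>a\<in>mspace (X v). \<forall>y\<in>space (prod_space X (parents G v)). p (a, y) \<ge> 0) \<and>
     (\<forall>y\<in>space (prod_space X (parents G v)). k y = density (\<mu> v) (\<lambda>a. ennreal (p (a, y))))"

definition BN_eqb ::
  "('v \<Rightarrow> 'a metric) \<Rightarrow> 'v set \<Rightarrow> real \<Rightarrow> (real \<Rightarrow> real) \<Rightarrow> ('v \<Rightarrow> 'a measure) \<Rightarrow> 'v rel \<Rightarrow>
     ('v \<Rightarrow> ('v \<Rightarrow> 'a) \<Rightarrow> 'a measure) set" where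
  "BN_eqb X V K \<omega> \<mu> G = {m. bayesian_network X V G m \<and>
     (\<forall>v\<in>V. \<exists>p. cond_density X \<mu> G v (m v) p \<and>
        (\<forall>z\<in>mspace (X v) \<times> space (prod_space X (parents G v)). p z \<le> K) \<and>
        admits_modulus (mspace (X v) \<times> space (prod_space X (parents G v)))
          (prod_dist (mdist (X v)) (prod_mdist X (parents G v))) \<omega> p)}"

definition BN_eqb_all ::
  "('v \<Rightarrow> 'a metric) \<Rightarrow> 'v set \<Rightarrow> real \<Rightarrow> (real \<Rightarrow> real) \<Rightarrow> ('v \<Rightarrow> 'a measure) \<Rightarrow>
     ('v rel \<times> ('v \<Rightarrow> ('v \<Rightarrow> 'a) \<Rightarrow> 'a measure)) set" where
  "BN_eqb_all X V K \<omega> \<mu> = (\<Union>G\<in>{G. dag V G}. {G} \<times> BN_eqb X V K \<omega> \<mu> G)"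


section \<open>Consistent testability\<close>

text \<open>
  \<open>H 0\<close> and \<open>H 1\<close> are the hypotheses in the model \<open>PP\<close> of distributions on \<open>M\<close>.
\<close>

definition consistently_testable ::
  "'b measure \<Rightarrow> 'b measure set \<Rightarrow> (nat \<Rightarrow> 'b measure set) \<Rightarrow> bool" where
  "consistently_testable M PP H \<longleftrightarrow>
     (\<exists>\<phi> :: nat \<Rightarrow> (nat \<Rightarrow> 'b) \<Rightarrow> nat.
        (\<forall>n. \<phi> n \<in> PiM {..<n} (\<lambda>_. M) \<rightarrow>\<^sub>M count_space {0, 1}) \<and>
        (\<forall>P\<in>PP. \<forall>i\<in>{0, 1}.
           (\<lambda>n. measure (PiM {..<n} (\<lambda>_. P)) {x \<in> space (PiM {..<n} (\<lambda>_. P)). \<phi> n x = i})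
             \<longlonglongrightarrow> 1
           \<longleftrightarrow> P \<in> H i))"

end

theory Submission
  imports Defs "HOL-Real_Asymp.Real_Asymp"
begin

text \<open>
  The networks in the model have joint densities with respect to \<open>\<mu>\<close> that are uniformly
  equicontinuous, whatever the graph. Take a countable family of boxes of arbitrarily small diameter
  and finite measure. If the probabilities of all these boxes converge along a sequence of model
  distributions to those of another model distribution, then averaging over small boxes of positive
  measure shows that the densities converge almost everywhere, hence in \<open>L\<^sup>1\<close> by Scheffe's lemma.
  Conditional independence passes to limits in total variation. So a distribution
  violating it differs from all distributions in \<open>H0\<close> by a fixed amount on one of finitely many
  boxes, and comparing empirical box frequencies with \<open>H0\<close> gives a test, which is consistent by
  Hoeffding's inequality.
\<close>

section \<open>Conditional independence and total variation\<close>

text \<open>Conditional independence is not preserved by weak limits, while empirical measures in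
  general do not approximate the true law in total variation. Equicontinuity bridges this gap:
  inside the model, convergence on countably many boxes is already convergence in total variation.
  Since the limit is itself a member of the model, closedness of \<open>H0\<close> relative to
  \<open>PP\<close> suffices in place of compactness. A relatively closed hypothesis can be tested
  against its complement by letting the tolerance shrink slowly while the number of inspected boxes
  grows. The graph may change along the approximating sequence, so the modulus of the joint density
  has to be independent of it.

  A second obstacle is that a conditional probability under \<open>Q\<close> is determined only up
  to \<open>Q\<close>-null sets, which \<open>P\<close> may charge. Total variation nevertheless
  compares the integrals of one fixed bounded function under both measures, so the argument fixes
  versions and only ever compares integrals.\<close>

text \<open>The bounds 0 and 1 must hold at every point: a version built from one measure gets
  integrated against another, for which bounds holding almost everywhere under the first say
  nothing.\<close>

definition clamped_cond_prob :: "'b measure \<Rightarrow> 'b measure \<Rightarrow> 'b set \<Rightarrow> 'b \<Rightarrow> real" where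
  "clamped_cond_prob P F E x = max 0 (min 1 (real_cond_exp P F (indicator E) x))"

lemma clamped_cond_prob_bounds: "0 \<le> clamped_cond_prob P F E x" "clamped_cond_prob P F E x \<le> 1"
  by (auto simp: clamped_cond_prob_def)

lemma clamped_cond_prob_measurable [measurable]: "clamped_cond_prob P F E \<in> borel_measurable F"
  unfolding clamped_cond_prob_def by measurable

lemma clamped_cond_prob_AE:
  assumes "prob_space P" "subalgebra P F" "E \<in> sets P"
  shows "AE x in P. real_cond_exp P F (indicator E) x = clamped_cond_prob P F E x"
proof -
  interpret prob_space P by fact
  interpret finite_measure_subalgebra P F by unfold_locales fact
  have i: "integrable P (indicator E :: _ \<Rightarrow> real)"
    using assms(3) by (simp add: integrable_indicator_iff emeasure_eq_measure)
  have "AE x in P. real_cond_exp P F (indicator E) x \<ge> 0"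
    by (rule real_cond_exp_ge_c[OF i]) auto
  moreover have "AE x in P. real_cond_exp P F (indicator E) x \<le> 1"
    by (rule real_cond_exp_le_c[OF i]) auto
  ultimately show ?thesis by eventually_elim (auto simp: clamped_cond_prob_def)
qed

lemma integral_clamped_cond_prob:
  assumes "prob_space P" "subalgebra P F" "E \<in> sets P"
    and [measurable]: "h \<in> borel_measurable F" and h: "\<And>x. \<bar>h x\<bar> \<le> 1"
  shows "(\<integral>x. h x * clamped_cond_prob P F E x \<partial>P) = (\<integral>x. h x * indicator E x \<partial>P)"
proof -
  interpret prob_space P by fact
  interpret finite_measure_subalgebra P F by unfold_locales fact
  note [measurable] = assms(3) measurable_from_subalg[OF assms(2), of h]
    measurable_from_subalg[OF assms(2) clamped_cond_prob_measurable]
    measurable_from_subalg[OF assms(2) borel_measurable_cond_exp]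
  have "(\<integral>x. h x * clamped_cond_prob P F E x \<partial>P) = (\<integral>x. h x * real_cond_exp P F (indicator E) x \<partial>P)"
    using clamped_cond_prob_AE[OF assms(1-3)] by (intro integral_cong_AE) auto
  also have "\<dots> = (\<integral>x. h x * indicator E x \<partial>P)"
    using h by (intro real_cond_exp_intg integrable_const_bound[of _ 1])
      (auto simp: abs_mult indicator_def)
  finally show ?thesis .
qed

text \<open>Testing both conditional probabilities against the sign of their difference, which is
  measurable with respect to the conditioning algebra, bounds their distance.\<close>

lemma clamped_cond_prob_diff:
  assumes P: "prob_space P" and Q: "prob_space Q" and sets: "sets Q = sets P"
    and F: "subalgebra P F" and E: "E \<in> sets P"
    and tv: "\<And>h. h \<in> borel_measurable P \<Longrightarrow> (\<And>x. \<bar>h x\<bar> \<le> 1) \<Longrightarrow> \<bar>(\<integral>x. h x \<partial>P) - (\<integral>x. h x \<partial>Q)\<bar> \<le> \<delta>"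
  shows "(\<integral>x. \<bar>clamped_cond_prob P F E x - clamped_cond_prob Q F E x\<bar> \<partial>P) \<le> 2 * \<delta>"
proof -
  interpret P: prob_space P by fact
  define f g where "f = clamped_cond_prob P F E" and "g = clamped_cond_prob Q F E"
  define h where "h x = (if g x \<le> f x then 1 else - 1 :: real)" for x
  have FQ: "subalgebra Q F" using F sets sets_eq_imp_space_eq[OF sets] by (simp add: subalgebra_def)
  have mF: "f \<in> borel_measurable F" "g \<in> borel_measurable F" unfolding f_def g_def by measurable
  note [measurable] = mF
  have hF: "h \<in> borel_measurable F" unfolding h_def by measurable
  have h1: "\<bar>h x\<bar> \<le> 1" for x by (simp add: h_def)
  note [measurable] = E measurable_from_subalg[OF F mF(1)] measurable_from_subalg[OF F mF(2)]
    measurable_from_subalg[OF F hF]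
  have b: "0 \<le> f x" "f x \<le> 1" "0 \<le> g x" "g x \<le> 1" for x
    by (simp_all add: f_def g_def clamped_cond_prob_bounds)
  have hE: "\<bar>h x * indicator E x\<bar> \<le> 1" for x
    by (auto simp: h_def indicator_def)
  have hf: "\<bar>h x * f x\<bar> \<le> 1" and hg: "\<bar>h x * g x\<bar> \<le> 1" for x
    using b[of x] by (auto simp: h_def)
  have "(\<integral>x. \<bar>f x - g x\<bar> \<partial>P) = (\<integral>x. h x * f x - h x * g x \<partial>P)"
    by (intro Bochner_Integration.integral_cong) (auto simp: h_def)
  also have "\<dots> = (\<integral>x. h x * f x \<partial>P) - (\<integral>x. h x * g x \<partial>P)"
    using hf hg by (intro Bochner_Integration.integral_diff P.integrable_const_bound[of _ 1]) auto
  also have "(\<integral>x. h x * f x \<partial>P) = (\<integral>x. h x * indicator E x \<partial>P)"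
    unfolding f_def by (rule integral_clamped_cond_prob[OF P F E hF h1])
  \<comment> \<open>\<open>g\<close> belongs to \<open>Q\<close> but is integrated against
    \<open>P\<close>. Moving both integrals to \<open>Q\<close> costs \<open>\<delta>\<close> each;
    there the defining property of \<open>g\<close> makes them cancel.\<close>
  also have "\<dots> - (\<integral>x. h x * g x \<partial>P) \<le>
      ((\<integral>x. h x * indicator E x \<partial>Q) + \<delta>) - ((\<integral>x. h x * g x \<partial>Q) - \<delta>)"
    using tv[of "\<lambda>x. h x * indicator E x"] tv[of "\<lambda>x. h x * g x"] hg hE
    by (simp add: abs_le_iff)
  also have "(\<integral>x. h x * g x \<partial>Q) = (\<integral>x. h x * indicator E x \<partial>Q)"
    unfolding g_def using E sets by (intro integral_clamped_cond_prob[OF Q FQ _ hF h1]) auto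
  finally show ?thesis by (simp add: f_def g_def)
qed

text \<open>The product of the two conditional probabilities is identified through its integrals
  over sets \<open>D\<close> of the conditioning algebra. The factorisation is available only almost
  everywhere under \<open>Q n\<close>, so each such integral is carried to \<open>Q n\<close>,
  factorised there, and carried back.\<close>

lemma cond_prob_product_tv_limit:
  assumes P: "prob_space P" and Q: "\<And>n. prob_space (Q n)" and sets: "\<And>n. sets (Q n) = sets P"
    and F: "subalgebra P F" and E: "E1 \<in> sets P" "E2 \<in> sets P"
    and tv: "\<And>n h. h \<in> borel_measurable P \<Longrightarrow> (\<And>x. \<bar>h x\<bar> \<le> 1) \<Longrightarrow>
        \<bar>(\<integral>x. h x \<partial>P) - (\<integral>x. h x \<partial>(Q n))\<bar> \<le> \<delta> n"
    and \<delta>: "\<delta> \<longlonglongrightarrow> (0::real)"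
    and ci: "\<And>n. AE x in Q n. real_cond_exp (Q n) F (indicator (E1 \<inter> E2)) x =
        real_cond_exp (Q n) F (indicator E1) x * real_cond_exp (Q n) F (indicator E2) x"
  shows "AE x in P. real_cond_exp P F (indicator (E1 \<inter> E2)) x =
        real_cond_exp P F (indicator E1) x * real_cond_exp P F (indicator E2) x"
proof -
  interpret P: prob_space P by fact
  interpret finite_measure_subalgebra P F by unfold_locales fact
  have FQ: "subalgebra (Q n) F" for n
    using F sets[of n] sets_eq_imp_space_eq[OF sets[of n]] by (simp add: subalgebra_def)
  let ?f = "clamped_cond_prob P F E1" and ?g = "clamped_cond_prob P F E2"
  let ?fn = "\<lambda>n. clamped_cond_prob (Q n) F E1" and ?gn = "\<lambda>n. clamped_cond_prob (Q n) F E2"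
  have clP[measurable]: "clamped_cond_prob R F E' \<in> borel_measurable P" for R E'
    by (rule measurable_from_subalg[OF F clamped_cond_prob_measurable])
  have clQ[measurable]: "clamped_cond_prob R F E' \<in> borel_measurable (Q n)" for R E' n
    by (rule measurable_from_subalg[OF FQ clamped_cond_prob_measurable])
  have ceQ[measurable]: "real_cond_exp (Q n) F E' \<in> borel_measurable (Q n)" for E' n
    by (rule measurable_from_subalg[OF FQ borel_measurable_cond_exp])
  note [measurable] = E
  have EQ: "E1 \<in> sets (Q n)" "E2 \<in> sets (Q n)" for n using E sets by auto
  note b = clamped_cond_prob_bounds
  have fg1: "\<bar>clamped_cond_prob R F S x * clamped_cond_prob R' F S' x\<bar> \<le> 1" for R R' S S' x
    by (simp add: abs_mult mult_le_one b abs_of_nonneg)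
  have "AE x in P. real_cond_exp P F (indicator (E1 \<inter> E2)) x = ?f x * ?g x"
  proof (rule real_cond_exp_charact)
    fix D assume D: "D \<in> sets F"
    have DP[measurable]: "D \<in> sets P" using D F by (auto simp: subalgebra_def)
    have DQ: "D \<in> sets (Q n)" for n using DP sets by auto
    let ?L = "\<integral>x. indicator D x * indicator (E1 \<inter> E2) x \<partial>P"
    let ?R = "\<integral>x. indicator D x * (?f x * ?g x) \<partial>P"
    have int1: "integrable P (\<lambda>x. indicator D x * (clamped_cond_prob R F S x * clamped_cond_prob R' F S' x))"
      for R R' S S'
      using fg1 by (intro P.integrable_const_bound[of _ 1]) (auto simp: indicator_def)
    have int2: "integrable P (\<lambda>x. \<bar>clamped_cond_prob R F S x - clamped_cond_prob R' F S x\<bar>)" for R R' S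
    proof (intro P.integrable_const_bound[of _ 1] AE_I2)
      show "norm \<bar>clamped_cond_prob R F S x - clamped_cond_prob R' F S x\<bar> \<le> 1" for x
        using b[of R F S x] b[of R' F S x] by (simp add: abs_le_iff)
    qed measurable
    \<comment> \<open>One \<open>\<delta> n\<close> for passing to \<open>Q n\<close>, one for
      returning to \<open>P\<close>, and four for replacing the two \<open>Q n\<close>-versions by
      the \<open>P\<close>-versions, at \<open>2 * \<delta> n\<close> each.\<close>
    have "\<bar>?L - ?R\<bar> \<le> 6 * \<delta> n" for n
    proof -
      let ?Rn = "\<lambda>M. \<integral>x. indicator D x * (?fn n x * ?gn n x) \<partial>M"
      have "\<bar>?L - (\<integral>x. indicator D x * indicator (E1 \<inter> E2) x \<partial>(Q n))\<bar> \<le> \<delta> n"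
        by (rule tv) (auto simp: indicator_def)
      moreover have "(\<integral>x. indicator D x * indicator (E1 \<inter> E2) x \<partial>(Q n)) = ?Rn (Q n)"
      proof -
        have [measurable]: "D \<in> sets (Q n)" by fact
        have "(\<integral>x. indicator D x * indicator (E1 \<inter> E2) x \<partial>(Q n)) =
          (\<integral>x. indicator D x * clamped_cond_prob (Q n) F (E1 \<inter> E2) x \<partial>(Q n))"
          using D EQ by (intro integral_clamped_cond_prob[symmetric, OF Q FQ]) (auto simp: indicator_def)
        also have "\<dots> = ?Rn (Q n)"
        proof (intro integral_cong_AE)
          show "AE x in Q n. indicator D x * clamped_cond_prob (Q n) F (E1 \<inter> E2) x =
              indicator D x * (?fn n x * ?gn n x)"
            using ci[of n] clamped_cond_prob_AE[OF Q FQ EQ(1), of n] clamped_cond_prob_AE[OF Q FQ EQ(2), of n]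
              clamped_cond_prob_AE[OF Q FQ, of "E1 \<inter> E2" n] EQ[of n]
            by (auto elim!: eventually_elim2)
        qed measurable
        finally show ?thesis .
      qed
      moreover have "\<bar>?Rn P - ?Rn (Q n)\<bar> \<le> \<delta> n"
        using fg1 by (intro tv) (auto simp: indicator_def)
      moreover have "\<bar>?Rn P - ?R\<bar> \<le> 4 * \<delta> n"
      proof -
        have "\<bar>?Rn P - ?R\<bar> = \<bar>\<integral>x. indicator D x * (?fn n x * ?gn n x) - indicator D x * (?f x * ?g x) \<partial>P\<bar>"
          by (simp add: int1)
        also have "\<dots> \<le> (\<integral>x. \<bar>indicator D x * (?fn n x * ?gn n x) - indicator D x * (?f x * ?g x)\<bar> \<partial>P)"
          by (rule integral_abs_bound)
        also have "\<dots> \<le> (\<integral>x. \<bar>?f x - ?fn n x\<bar> + \<bar>?g x - ?gn n x\<bar> \<partial>P)"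
        proof (intro integral_mono Bochner_Integration.integrable_add int2 integrable_abs
            Bochner_Integration.integrable_diff int1)
          fix x
          have "?fn n x * ?gn n x - ?f x * ?g x = (?fn n x - ?f x) * ?gn n x + ?f x * (?gn n x - ?g x)"
            by (simp add: algebra_simps)
          also have "\<bar>\<dots>\<bar> \<le> \<bar>?fn n x - ?f x\<bar> * \<bar>?gn n x\<bar> + \<bar>?f x\<bar> * \<bar>?gn n x - ?g x\<bar>"
            by (metis abs_triangle_ineq abs_mult)
          also have "\<dots> \<le> \<bar>?fn n x - ?f x\<bar> * 1 + 1 * \<bar>?gn n x - ?g x\<bar>"
            by (intro add_mono mult_mono) (auto simp: b abs_of_nonneg)
          finally have "\<bar>?fn n x * ?gn n x - ?f x * ?g x\<bar> \<le> \<bar>?f x - ?fn n x\<bar> + \<bar>?g x - ?gn n x\<bar>"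
            by (simp add: abs_minus_commute)
          then show "\<bar>indicator D x * (?fn n x * ?gn n x) - indicator D x * (?f x * ?g x)\<bar>
              \<le> \<bar>?f x - ?fn n x\<bar> + \<bar>?g x - ?gn n x\<bar>"
            by (simp add: indicator_def)
        qed
        also have "\<dots> = (\<integral>x. \<bar>?f x - ?fn n x\<bar> \<partial>P) + (\<integral>x. \<bar>?g x - ?gn n x\<bar> \<partial>P)"
          by (intro Bochner_Integration.integral_add int2)
        also have "\<dots> \<le> 2 * \<delta> n + 2 * \<delta> n"
          by (intro add_mono clamped_cond_prob_diff P Q sets F E tv) auto
        finally show ?thesis by simp
      qed
      ultimately show ?thesis by linarith
    qed
    then have "\<bar>?L - ?R\<bar> \<le> 0"
      by (intro LIMSEQ_le_const[OF tendsto_mult_right_zero[OF \<delta>, of 6]]) auto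
    then show "(\<integral>x\<in>D. indicator (E1 \<inter> E2) x \<partial>P) = (\<integral>x\<in>D. ?f x * ?g x \<partial>P)"
      by (simp add: set_lebesgue_integral_def)
  next
    show "integrable P (\<lambda>x. ?f x * ?g x)"
      using fg1 by (intro P.integrable_const_bound[of _ 1]) auto
  qed (auto simp: E integrable_indicator_iff P.emeasure_eq_measure)
  with clamped_cond_prob_AE[OF P F E(1)] clamped_cond_prob_AE[OF P F E(2)]
  show ?thesis by eventually_elim simp
qed

section \<open>Tests based on empirical frequencies\<close>

text \<open>The coordinates of the product measure are independent with common law \<open>P\<close>,
  so this is Hoeffding's inequality for the indicators of \<open>A\<close> along the sample.
  Positivity of \<open>n\<close> provides coordinate 0, which serves as the reference
  variable.\<close>

lemma frequency_concentration:
  fixes \<epsilon> :: real and n :: nat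
  assumes P: "prob_space P" and A[measurable]: "A \<in> sets P" and n: "n > 0" and \<epsilon>: "\<epsilon> \<ge> 0"
  shows "measure (PiM {..<n} (\<lambda>_. P)) {x \<in> space (PiM {..<n} (\<lambda>_. P)).
      \<bar>real (card {i. i < n \<and> x i \<in> A}) / real n - measure P A\<bar> \<ge> \<epsilon>} \<le> 2 * exp (- 2 * real n * \<epsilon>\<^sup>2)"
proof -
  interpret P: prob_space P by fact
  let ?N = "PiM {..<n} (\<lambda>_. P)"
  interpret N: prob_space ?N by (intro prob_space_PiM P)
  let ?X = "\<lambda>i x. indicator A (x i) :: real"
  have d: "distr ?N borel (?X i) = distr P borel (indicator A)" if "i < n" for i
  proof -
    have "distr P borel (indicator A) = distr (distr ?N P (\<lambda>x. x i)) borel (indicator A)"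
      using that by (subst distr_PiM_component) (auto intro: P)
    also have "\<dots> = distr ?N borel (?X i)"
      using that by (subst distr_distr) (auto simp: comp_def)
    finally show ?thesis by simp
  qed
  have ind: "N.indep_vars (\<lambda>_. borel) ?X {..<n}"
  proof -
    have "N.indep_vars (\<lambda>_. P) (\<lambda>i x. x i) {..<n}"
    \<comment> \<open>Independence of the coordinates says that the joint law, here the law of the
      identity, is the product of the marginals.\<close>
    proof (subst N.indep_vars_iff_distr_eq_PiM')
      show "{..<n} \<noteq> {}" using n by auto
      have "distr ?N ?N (\<lambda>x. \<lambda>i\<in>{..<n}. x i) = distr ?N ?N (\<lambda>x. x)"
        by (intro distr_cong) (auto simp: space_PiM PiE_restrict)
      also have "\<dots> = ?N" by simp
      also have "\<dots> = PiM {..<n} (\<lambda>i. distr ?N P (\<lambda>x. x i))"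
        by (intro PiM_cong) (auto simp: distr_PiM_component[where M = "\<lambda>_. P", OF P])
      finally show "distr ?N ?N (\<lambda>x. \<lambda>i\<in>{..<n}. x i) = PiM {..<n} (\<lambda>i. distr ?N P (\<lambda>x. x i))" .
    qed auto
    then show ?thesis by (rule N.indep_vars_compose2) auto
  qed
  have "N.expectation (?X 0) = integral\<^sup>L (distr ?N borel (?X 0)) (\<lambda>x. x)"
    using n by (subst integral_distr) auto
  also have "\<dots> = integral\<^sup>L P (indicator A)"
    unfolding d[OF n] by (subst integral_distr) auto
  finally have ex: "N.expectation (?X 0) = measure P A" by simp
  interpret H: Hoeffding_ineq_iid ?N "{..<n}" ?X "?X 0" 0 1 "N.expectation (?X 0)"
  proof unfold_locales
    show "finite {..<n}" by simp
    show "N.indep_vars (\<lambda>_. borel) ?X {..<n}" by (rule ind)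
    show "distr ?N borel (?X i) = distr ?N borel (?X 0)" if "i \<in> {..<n}" for i
      using d[of i] d[of 0] that n by simp
    have "(\<lambda>x. x 0) \<in> ?N \<rightarrow>\<^sub>M P"
      using n by (intro measurable_component_singleton) simp
    then show "?X 0 \<in> borel_measurable ?N" by (rule measurable_compose) simp
    show "AE x in ?N. ?X 0 x \<in> {0..1}"
      by (simp add: indicator_def)
  qed simp
  have s: "(\<Sum>i<n. ?X i x) = real (card {i. i < n \<and> x i \<in> A})" for x :: "nat \<Rightarrow> 'a"
    by (simp add: indicator_def sum.If_cases Int_def)
  show ?thesis
    using H.Hoeffding_ineq_abs_ge'[OF \<epsilon>] n unfolding ex s by (simp add: lessThan_empty_iff)
qed

text \<open>The test accepts when some member of \<open>H0\<close> explains the frequencies of the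
  first \<open>n\<close> sets up to a tolerance. If \<open>P\<close> is in \<open>H0\<close>, then
  \<open>P\<close> itself is such a member with high probability. Otherwise closedness keeps
  \<open>P\<close> a fixed distance away from \<open>H0\<close> on finitely many sets, and the
  tolerance eventually drops below half of that distance.\<close>

lemma consistently_testable_closed:
  fixes F :: "nat \<Rightarrow> 'b set"
  assumes PP: "\<And>P. P \<in> PP \<Longrightarrow> prob_space P" "\<And>P. P \<in> PP \<Longrightarrow> sets P = sets M"
    and H0: "H0 \<subseteq> PP" and F: "\<And>j. F j \<in> sets M"
    and closed: "\<And>P Q. P \<in> PP \<Longrightarrow> (\<And>n. Q n \<in> H0) \<Longrightarrow>
      (\<And>j. (\<lambda>n. measure (Q n) (F j)) \<longlonglongrightarrow> measure P (F j)) \<Longrightarrow> P \<in> H0"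
  shows "consistently_testable M PP (\<lambda>i. if i = 0 then H0 else PP - H0)"
proof -
  \<comment> \<open>The tolerance has to vanish, yet slowly enough that \<open>n\<close>
    simultaneous Hoeffding bounds are summable to something small. The exponent gives
    \<open>n * (\<epsilon> n)\<^sup>2 = sqrt n\<close>, and \<open>n * exp (- 2 * sqrt n)\<close>
    tends to 0.\<close>
  define \<epsilon> where "\<epsilon> n = real n powr (-1/4)" for n :: nat
  have \<epsilon>0: "\<epsilon> \<longlonglongrightarrow> 0" unfolding \<epsilon>_def by real_asymp
  \<comment> \<open>The decision depends on the sample only through finitely many counts. They live
    in a countable discrete space, on which every predicate is measurable; so \<open>accept\<close>
    may quantify over an uncountable \<open>H0\<close>.\<close>
  define cnt where "cnt n x = (\<lambda>j\<in>{..<n}. card {i. i < n \<and> x i \<in> F j})" for n and x :: "nat \<Rightarrow> 'b"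
  define accept where "accept n c \<longleftrightarrow>
    (\<exists>Q\<in>H0. \<forall>j<n. \<bar>real (c j :: nat) / real n - measure Q (F j)\<bar> < \<epsilon> n)" for n c
  define \<phi> :: "nat \<Rightarrow> (nat \<Rightarrow> 'b) \<Rightarrow> nat" where "\<phi> n x = (if accept n (cnt n x) then 0 else 1)" for n x
  have cnt[measurable]: "cnt n \<in> PiM {..<n} (\<lambda>_. M) \<rightarrow>\<^sub>M count_space (PiE {..<n} (\<lambda>_. UNIV))" for n
  proof -
    have "(\<lambda>x. card {i. i < n \<and> x i \<in> F j}) \<in> PiM {..<n} (\<lambda>_. M) \<rightarrow>\<^sub>M count_space UNIV" for j
    proof -
      note [measurable] = F[of j]
      have "(\<lambda>x. \<Sum>i<n. if x i \<in> F j then 1 else 0 :: nat) \<in> PiM {..<n} (\<lambda>_. M) \<rightarrow>\<^sub>M count_space UNIV"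
        by measurable
      then show ?thesis by (simp add: sum.If_cases Int_def)
    qed
    then have "cnt n \<in> PiM {..<n} (\<lambda>_. M) \<rightarrow>\<^sub>M PiM {..<n} (\<lambda>_. count_space UNIV)"
      unfolding cnt_def by (intro measurable_restrict)
    then show ?thesis by (subst (asm) count_space_PiM_finite) auto
  qed
  have \<phi>m: "\<phi> n \<in> PiM {..<n} (\<lambda>_. M) \<rightarrow>\<^sub>M count_space {0, 1}" for n
    unfolding \<phi>_def by (rule measurable_compose[OF cnt]) (auto intro: measurable_count_space_eq1[THEN iffD2])
  have main: "(\<lambda>n. measure (PiM {..<n} (\<lambda>_. P)) {x \<in> space (PiM {..<n} (\<lambda>_. P)). \<phi> n x = i}) \<longlonglongrightarrow> 1"
    if P: "P \<in> PP" and i: "i = (if P \<in> H0 then 0 else 1)" for P i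
  proof -
    let ?N = "\<lambda>n::nat. PiM {..<n} (\<lambda>_. P)"
    interpret P: prob_space P by (rule PP) fact
    have N: "prob_space (?N n)" for n by (intro prob_space_PiM P.prob_space_axioms)
    have [measurable_cong]: "sets P = sets M" using P by (rule PP)
    note \<phi>m[measurable] F[measurable]
    have cardm[measurable]: "(\<lambda>x. card {i. i < n \<and> x i \<in> F j}) \<in> ?N n \<rightarrow>\<^sub>M count_space UNIV" for j n
    proof -
      have "(\<lambda>x. \<Sum>i<n. if x i \<in> F j then 1 else 0 :: nat) \<in> ?N n \<rightarrow>\<^sub>M count_space UNIV"
        by measurable
      then show ?thesis by (simp add: sum.If_cases Int_def)
    qed
    \<comment> \<open>The inequality complements the strict one in \<open>accept\<close>, so off all
      bad events the law \<open>P\<close> itself passes the comparison.\<close>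
    define bad where "bad n j = {x \<in> space (?N n).
        \<bar>real (card {i. i < n \<and> x i \<in> F j}) / real n - measure P (F j)\<bar> \<ge> \<epsilon> n}" for n j
    have badm[measurable]: "bad n j \<in> sets (?N n)" for n j unfolding bad_def by measurable
    have correct: "\<forall>\<^sub>F n in sequentially. \<forall>x\<in>space (?N n). \<phi> n x = i \<or> (\<exists>j<n. x \<in> bad n j)"
    proof (cases "P \<in> H0")
      case True
      then have "\<phi> n x = i" if "x \<in> space (?N n)" "\<not> (\<exists>j<n. x \<in> bad n j)" for n x
        using that i unfolding \<phi>_def accept_def bad_def cnt_def by (auto simp: not_le)
      then show ?thesis by (auto intro!: always_eventually)
    next
      case False
      \<comment> \<open>A single \<open>k\<close> bounds both the number of sets and the inverse of
        the gap. If no \<open>k\<close> worked, members of \<open>H0\<close> agreeing with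
        \<open>P\<close> up to \<open>1 / Suc k\<close> on the first \<open>k\<close> sets would
        converge to \<open>P\<close> on every \<open>F j\<close>, which forces \<open>P\<close> into
        \<open>H0\<close>.\<close>
      have "\<exists>k. \<forall>Q\<in>H0. \<exists>j<k. \<bar>measure Q (F j) - measure P (F j)\<bar> \<ge> 1 / Suc k"
      proof (rule ccontr)
        assume "\<not> ?thesis"
        then have "\<forall>k. \<exists>Q. Q \<in> H0 \<and> (\<forall>j<k. \<bar>measure Q (F j) - measure P (F j)\<bar> < 1 / Suc k)"
          by (auto simp: not_le)
        then obtain Q where Q: "\<And>k. Q k \<in> H0"
          "\<And>k j. j < k \<Longrightarrow> \<bar>measure (Q k) (F j) - measure P (F j)\<bar> < 1 / Suc k"
          by metis
        have "(\<lambda>k. measure (Q k) (F j)) \<longlonglongrightarrow> measure P (F j)" for j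
        proof (rule LIM_zero_cancel, rule Lim_null_comparison)
          show "\<forall>\<^sub>F k in sequentially. norm (measure (Q k) (F j) - measure P (F j)) \<le> 1 / Suc k"
            using eventually_gt_at_top[of j]
            by eventually_elim (simp only: real_norm_def, rule less_imp_le[OF Q(2)])
          show "(\<lambda>k. 1 / real (Suc k)) \<longlonglongrightarrow> 0" by real_asymp
        qed
        then have "P \<in> H0" by (rule closed[OF P Q(1)])
        with False show False by contradiction
      qed
      then obtain k where k: "\<And>Q. Q \<in> H0 \<Longrightarrow> \<exists>j<k. \<bar>measure Q (F j) - measure P (F j)\<bar> \<ge> 1 / Suc k"
        by blast
      \<comment> \<open>The factor 2 is for the triangle inequality: off the bad events, acceptance
        puts the frequency within \<open>\<epsilon> n\<close> of both \<open>P\<close> and some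
        \<open>Q\<close> in \<open>H0\<close>.\<close>
      have "\<forall>\<^sub>F n in sequentially. \<epsilon> n < 1 / (2 * Suc k)"
        by (rule order_tendstoD(2)[OF \<epsilon>0]) simp
      then show ?thesis using eventually_ge_at_top[of k]
      proof eventually_elim
        case (elim n)
        show ?case
        proof (intro ballI disjCI)
          fix x assume x: "x \<in> space (?N n)" and nb: "\<not> (\<exists>j<n. x \<in> bad n j)"
          have "\<not> accept n (cnt n x)"
          proof
            assume "accept n (cnt n x)"
            then obtain Q where Q: "Q \<in> H0"
              "\<And>j. j < n \<Longrightarrow> \<bar>real (cnt n x j) / real n - measure Q (F j)\<bar> < \<epsilon> n"
              unfolding accept_def by blast
            obtain j where j: "j < k" "\<bar>measure Q (F j) - measure P (F j)\<bar> \<ge> 1 / Suc k"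
              using k[OF Q(1)] by blast
            have jn: "j < n" using j elim by simp
            have "\<bar>real (cnt n x j) / real n - measure P (F j)\<bar> < \<epsilon> n"
              using nb jn x by (auto simp: bad_def cnt_def not_le)
            with Q(2)[OF jn] have "\<bar>measure Q (F j) - measure P (F j)\<bar> < 2 * \<epsilon> n" by linarith
            moreover have "2 * \<epsilon> n < 1 / Suc k" using elim(1) by (simp add: field_simps)
            ultimately show False using j(2) by linarith
          qed
          then show "\<phi> n x = i" using False i by (simp add: \<phi>_def)
        qed
      qed
    qed
    have rate: "real n * (\<epsilon> n)\<^sup>2 = sqrt n" if "n > 0" for n
    proof -
      have "real n * (\<epsilon> n)\<^sup>2 = real n powr 1 * (real n powr (-1/4) * real n powr (-1/4))"
        by (simp add: \<epsilon>_def power2_eq_square)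
      also have "\<dots> = real n powr (1/2)" by (simp only: powr_add[symmetric]) simp
      finally show ?thesis by (simp add: powr_half_sqrt)
    qed
    \<comment> \<open>Union bound over the \<open>n\<close> bad events.\<close>
    have lower: "\<forall>\<^sub>F n in sequentially. 1 - real n * (2 * exp (- 2 * sqrt (real n))) \<le>
        measure (?N n) {x \<in> space (?N n). \<phi> n x = i}"
      using correct eventually_gt_at_top[of 0]
    proof eventually_elim
      case (elim n)
      interpret N: prob_space "?N n" by (rule N)
      let ?G = "{x \<in> space (?N n). \<phi> n x = i}"
      have "space (?N n) \<subseteq> ?G \<union> (\<Union>j<n. bad n j)" using elim(1) by auto
      then have "N.prob (space (?N n)) \<le> N.prob (?G \<union> (\<Union>j<n. bad n j))"
        by (intro N.finite_measure_mono) auto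
      then have "1 \<le> N.prob (?G \<union> (\<Union>j<n. bad n j))" by (simp add: N.prob_space)
      moreover have "N.prob (?G \<union> (\<Union>j<n. bad n j)) \<le> N.prob ?G + N.prob (\<Union>j<n. bad n j)"
        by (rule measure_Un_le) auto
      moreover have "N.prob (\<Union>j<n. bad n j) \<le> (\<Sum>j<n. N.prob (bad n j))"
        by (rule N.finite_measure_subadditive_finite) auto
      moreover have "(\<Sum>j<n. N.prob (bad n j)) \<le> (\<Sum>j<n. 2 * exp (- 2 * sqrt (real n)))"
      proof (rule sum_mono)
        fix j
        have F': "F j \<in> sets P" by measurable
        have eq: "- 2 * real n * (\<epsilon> n)\<^sup>2 = - 2 * sqrt (real n)"
          using rate[OF elim(2)] by (simp only: mult.assoc)
        have "N.prob (bad n j) \<le> 2 * exp (- 2 * real n * (\<epsilon> n)\<^sup>2)"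
          unfolding bad_def
          by (rule frequency_concentration[OF P.prob_space_axioms F' elim(2)]) (simp add: \<epsilon>_def)
        then show "N.prob (bad n j) \<le> 2 * exp (- 2 * sqrt (real n))" by (simp only: eq)
      qed
      ultimately show ?case by simp
    qed
    have lim: "(\<lambda>n. 1 - real n * (2 * exp (- 2 * sqrt (real n)))) \<longlonglongrightarrow> 1"
      by real_asymp
    show ?thesis
      by (rule tendsto_sandwich[OF lower _ lim tendsto_const])
        (intro always_eventually allI prob_space.prob_le_1 N)
  qed
  have "(\<lambda>n. measure (PiM {..<n} (\<lambda>_. P)) {x \<in> space (PiM {..<n} (\<lambda>_. P)). \<phi> n x = i}) \<longlonglongrightarrow> 1
      \<longleftrightarrow> P \<in> (if i = 0 then H0 else PP - H0)" if P: "P \<in> PP" and i: "i \<in> {0, 1}" for P i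
  proof -
    define i0 :: nat where "i0 = (if P \<in> H0 then 0 else 1)"
    let ?N = "\<lambda>n::nat. PiM {..<n} (\<lambda>_. P)"
    have lim: "(\<lambda>n. measure (?N n) {x \<in> space (?N n). \<phi> n x = i0}) \<longlonglongrightarrow> 1"
      by (rule main[OF P]) (simp add: i0_def)
    \<comment> \<open>The events for two different answers are disjoint, so their probabilities
      cannot both tend to 1. This turns convergence for the right answer into the required
      equivalence.\<close>
    have "i = i0" if *: "(\<lambda>n. measure (?N n) {x \<in> space (?N n). \<phi> n x = i}) \<longlonglongrightarrow> 1"
    proof (rule ccontr)
      assume ne: "i \<noteq> i0"
      have "measure (?N n) {x \<in> space (?N n). \<phi> n x = i} + measure (?N n) {x \<in> space (?N n). \<phi> n x = i0} \<le> 1" for n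
      proof -
        interpret N: prob_space "?N n" by (intro prob_space_PiM PP P)
        have [measurable]: "\<phi> n \<in> ?N n \<rightarrow>\<^sub>M count_space {0, 1}"
          using \<phi>m[of n] by (subst measurable_cong_sets[OF sets_PiM_cong[OF refl PP(2)[OF P]] refl])
        have "measure (?N n) {x \<in> space (?N n). \<phi> n x = i} + measure (?N n) {x \<in> space (?N n). \<phi> n x = i0}
          = measure (?N n) ({x \<in> space (?N n). \<phi> n x = i} \<union> {x \<in> space (?N n). \<phi> n x = i0})"
          using ne by (intro N.finite_measure_Union[symmetric]) auto
        then show ?thesis by simp
      qed
      with tendsto_add[OF * lim] have "(1::real) + 1 \<le> 1" by (intro LIMSEQ_le_const2) auto
      then show False by simp
    qed
    then show ?thesis using lim P i by (auto simp: i0_def split: if_splits)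
  qed
  with \<phi>m show ?thesis unfolding consistently_testable_def by (intro exI[of _ \<phi>]) auto
qed

section \<open>Convergence of densities\<close>

lemma density_L1_limit:
  fixes q :: "nat \<Rightarrow> 'b \<Rightarrow> real" and p :: "'b \<Rightarrow> real"
  assumes p[measurable]: "p \<in> borel_measurable M" and q[measurable]: "\<And>n. q n \<in> borel_measurable M"
    and nn: "\<And>x. x \<in> space M \<Longrightarrow> 0 \<le> p x" "\<And>n x. x \<in> space M \<Longrightarrow> 0 \<le> q n x"
    and prob: "prob_space (density M (\<lambda>x. ennreal (p x)))" "\<And>n. prob_space (density M (\<lambda>x. ennreal (q n x)))"
    and ae: "AE x in M. (\<lambda>n. q n x) \<longlonglongrightarrow> p x"
  shows "\<exists>\<delta>. \<delta> \<longlonglongrightarrow> (0::real) \<and> (\<forall>n. \<forall>h\<in>borel_measurable M. (\<forall>x. \<bar>h x\<bar> \<le> 1) \<longrightarrow>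
      \<bar>(\<integral>x. h x \<partial>density M (\<lambda>x. ennreal (p x))) - (\<integral>x. h x \<partial>density M (\<lambda>x. ennreal (q n x)))\<bar> \<le> \<delta> n)"
proof -
  have mass: "(\<integral>\<^sup>+x. ennreal \<bar>f x\<bar> \<partial>M) = 1"
    if "prob_space (density M (\<lambda>x. ennreal (f x)))" "f \<in> borel_measurable M" "\<And>x. x \<in> space M \<Longrightarrow> 0 \<le> f x"
    for f :: "'b \<Rightarrow> real"
  proof -
    note that(2)[measurable]
    have "1 = emeasure (density M (\<lambda>x. ennreal (f x))) (space M)"
      using prob_space.emeasure_space_1[OF that(1)] by simp
    also have "\<dots> = (\<integral>\<^sup>+x. ennreal (f x) * indicator (space M) x \<partial>M)"
      by (rule emeasure_density) auto
    also have "\<dots> = (\<integral>\<^sup>+x. ennreal \<bar>f x\<bar> \<partial>M)"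
      by (intro nn_integral_cong) (auto simp: that(3))
    finally show ?thesis by simp
  qed
  have ip: "integrable M p" and iq: "integrable M (q n)" for n
    using mass[OF prob(1) p nn(1)] mass[OF prob(2) q nn(2)] by (auto simp: integrable_iff_bounded)
  define \<delta> where "\<delta> n = (\<integral>x. \<bar>q n x - p x\<bar> \<partial>M)" for n
  have "(\<lambda>n. \<integral>\<^sup>+x. norm (q n x - p x) \<partial>M) \<longlonglongrightarrow> 0"
    using mass[OF prob(1) p nn(1)] mass[OF prob(2) q nn(2)]
    by (intro Scheffe_lemma2 ip q ae) simp
  moreover have "(\<integral>\<^sup>+x. norm (q n x - p x) \<partial>M) = ennreal (\<delta> n)" for n
    unfolding \<delta>_def by (simp add: nn_integral_eq_integral ip iq)
  ultimately have "(\<lambda>n. ennreal (\<delta> n)) \<longlonglongrightarrow> ennreal 0" by simp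
  then have lim: "\<delta> \<longlonglongrightarrow> 0" by (rule tendsto_ennrealD) (auto simp: \<delta>_def)
  have "\<bar>(\<integral>x. h x \<partial>density M (\<lambda>x. ennreal (p x))) - (\<integral>x. h x \<partial>density M (\<lambda>x. ennreal (q n x)))\<bar> \<le> \<delta> n"
    if h[measurable]: "h \<in> borel_measurable M" and h1: "\<And>x. \<bar>h x\<bar> \<le> 1" for n and h :: "'b \<Rightarrow> real"
  proof -
    have dens: "(\<integral>x. h x \<partial>density M (\<lambda>x. ennreal (f x))) = (\<integral>x. f x * h x \<partial>M)"
      if "f \<in> borel_measurable M" "\<And>x. x \<in> space M \<Longrightarrow> 0 \<le> f x" for f
      using that by (subst integral_density) (auto intro: AE_I2)
    have mi: "integrable M (\<lambda>x. f x * h x)" if "integrable M f" for f :: "'b \<Rightarrow> real"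
      using that h1 by (rule_tac Bochner_Integration.integrable_bound[OF that])
        (auto simp: abs_mult intro!: AE_I2 mult_left_le)
    have "\<bar>(\<integral>x. p x * h x \<partial>M) - (\<integral>x. q n x * h x \<partial>M)\<bar> = \<bar>\<integral>x. p x * h x - q n x * h x \<partial>M\<bar>"
      by (simp add: mi ip iq)
    also have "\<dots> \<le> (\<integral>x. \<bar>p x * h x - q n x * h x\<bar> \<partial>M)" by (rule integral_abs_bound)
    also have "\<dots> \<le> \<delta> n"
      unfolding \<delta>_def
    proof (intro integral_mono integrable_abs Bochner_Integration.integrable_diff mi ip iq)
      fix x
      have "\<bar>p x * h x - q n x * h x\<bar> = \<bar>q n x - p x\<bar> * \<bar>h x\<bar>"
        by (simp add: abs_mult abs_minus_commute flip: left_diff_distrib)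
      also have "\<dots> \<le> \<bar>q n x - p x\<bar>" using h1 by (intro mult_left_le) auto
      finally show "\<bar>p x * h x - q n x * h x\<bar> \<le> \<bar>q n x - p x\<bar>" .
    qed
    finally show ?thesis by (simp add: dens nn)
  qed
  with lim show ?thesis by (intro exI[of _ \<delta>]) simp
qed

text \<open>Written without dividing by \<open>measure M A\<close>, so that null sets need no
  separate treatment.\<close>

lemma density_average:
  fixes f :: "'b \<Rightarrow> real"
  assumes [measurable]: "f \<in> borel_measurable M" and A[measurable]: "A \<in> sets M"
    and fin: "emeasure M A < \<infinity>" and osc: "\<And>y. y \<in> A \<Longrightarrow> \<bar>f y - c\<bar> \<le> \<epsilon>"
    and c: "0 \<le> c" and \<epsilon>: "0 \<le> \<epsilon>"
  shows "\<bar>measure (density M (\<lambda>x. ennreal (f x))) A - c * measure M A\<bar> \<le> \<epsilon> * measure M A"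
proof -
  let ?D = "density M (\<lambda>x. ennreal (f x))"
  have eM: "emeasure M A = ennreal (measure M A)"
    using fin by (intro emeasure_eq_ennreal_measure) auto
  have e: "emeasure ?D A = (\<integral>\<^sup>+x. ennreal (f x) * indicator A x \<partial>M)"
    by (rule emeasure_density) auto
  have "emeasure ?D A \<le> (\<integral>\<^sup>+x. ennreal (c + \<epsilon>) * indicator A x \<partial>M)"
    unfolding e
  proof (intro nn_integral_mono)
    fix x show "ennreal (f x) * indicator A x \<le> ennreal (c + \<epsilon>) * indicator A x"
      using osc[of x] by (cases "x \<in> A") (auto intro!: ennreal_leI)
  qed
  also have "\<dots> = ennreal (c + \<epsilon>) * ennreal (measure M A)" by (simp add: nn_integral_cmult_indicator eM)
  also have "\<dots> = ennreal ((c + \<epsilon>) * measure M A)" using c \<epsilon> by (simp add: ennreal_mult)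
  finally have up: "emeasure ?D A \<le> ennreal ((c + \<epsilon>) * measure M A)" .
  then have eD: "emeasure ?D A = ennreal (measure ?D A)"
    by (intro emeasure_eq_ennreal_measure) (auto simp: top_unique)
  \<comment> \<open>If \<open>c - \<epsilon>\<close> is negative, \<open>ennreal\<close> truncates
    it to 0 and the lower bound is trivially true.\<close>
  have "ennreal ((c - \<epsilon>) * measure M A) = ennreal (c - \<epsilon>) * ennreal (measure M A)"
    by (simp add: ennreal_mult'')
  also have "\<dots> = (\<integral>\<^sup>+x. ennreal (c - \<epsilon>) * indicator A x \<partial>M)"
    by (simp add: nn_integral_cmult_indicator eM)
  also have "\<dots> \<le> emeasure ?D A"
    unfolding e
  proof (intro nn_integral_mono)
    fix x show "ennreal (c - \<epsilon>) * indicator A x \<le> ennreal (f x) * indicator A x"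
      using osc[of x] by (cases "x \<in> A") (auto intro!: ennreal_leI)
  qed
  finally have "(c - \<epsilon>) * measure M A \<le> measure ?D A" unfolding eD by (simp add: ennreal_le_iff)
  moreover have "measure ?D A \<le> (c + \<epsilon>) * measure M A"
    using up c \<epsilon> unfolding eD by (subst (asm) ennreal_le_iff) auto
  ultimately show ?thesis by (auto simp: abs_le_iff algebra_simps)
qed

text \<open>Off the union of the null sets in \<open>\<F>\<close>, a density is recovered up to its oscillation
  as an average over a member of \<open>\<F>\<close> of positive measure.\<close>

lemma density_AE_limit:
  fixes q :: "nat \<Rightarrow> 'b \<Rightarrow> real" and p :: "'b \<Rightarrow> real"
  assumes p[measurable]: "p \<in> borel_measurable M" and q[measurable]: "\<And>n. q n \<in> borel_measurable M"
    and nn: "\<And>x. x \<in> space M \<Longrightarrow> 0 \<le> p x" "\<And>n x. x \<in> space M \<Longrightarrow> 0 \<le> q n x"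
    and \<F>: "countable \<F>" "\<And>A. A \<in> \<F> \<Longrightarrow> A \<in> sets M" "\<And>A. A \<in> \<F> \<Longrightarrow> emeasure M A < \<infinity>"
    and osc: "\<And>x \<epsilon>. x \<in> space M \<Longrightarrow> 0 < \<epsilon> \<Longrightarrow>
      \<exists>A\<in>\<F>. x \<in> A \<and> (\<forall>y\<in>A. \<bar>p y - p x\<bar> \<le> \<epsilon> \<and> (\<forall>n. \<bar>q n y - q n x\<bar> \<le> \<epsilon>))"
    and conv: "\<And>A. A \<in> \<F> \<Longrightarrow> (\<lambda>n. measure (density M (\<lambda>x. ennreal (q n x))) A)
        \<longlonglongrightarrow> measure (density M (\<lambda>x. ennreal (p x))) A"
  shows "AE x in M. (\<lambda>n. q n x) \<longlonglongrightarrow> p x"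
proof -
  have "AE x in M. \<forall>A\<in>{A\<in>\<F>. emeasure M A = 0}. x \<notin> A"
    using \<F> by (intro AE_ball_countable' AE_not_in) (auto simp: null_sets_def)
  moreover have "(\<lambda>n. q n x) \<longlonglongrightarrow> p x"
    if x: "x \<in> space M" and pos: "\<forall>A\<in>{A\<in>\<F>. emeasure M A = 0}. x \<notin> A" for x
  proof (rule metric_LIMSEQ_I)
    fix r :: real assume r: "0 < r"
    \<comment> \<open>Three errors of size \<open>\<epsilon> * m\<close> occur: averaging
      \<open>p\<close>, averaging \<open>q n\<close>, and the difference of the probabilities of
      \<open>A\<close>. Division by \<open>m\<close> leaves \<open>3 * \<epsilon>\<close>, which is
      below \<open>r\<close>.\<close>
    define \<epsilon> where "\<epsilon> = r / 4"
    have \<epsilon>: "0 < \<epsilon>" using r by (simp add: \<epsilon>_def)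
    obtain A where A: "A \<in> \<F>" "x \<in> A" "\<And>y. y \<in> A \<Longrightarrow> \<bar>p y - p x\<bar> \<le> \<epsilon>"
      "\<And>y n. y \<in> A \<Longrightarrow> \<bar>q n y - q n x\<bar> \<le> \<epsilon>"
      using osc[OF x \<epsilon>] by blast
    define m where "m = measure M A"
    have "emeasure M A \<noteq> 0" "emeasure M A < \<infinity>" using pos A \<F> by auto
    then have m: "0 < m"
      using emeasure_eq_ennreal_measure[of M A]
      by (auto simp: m_def zero_less_measure_iff less_top)
    let ?P = "density M (\<lambda>x. ennreal (p x))" and ?Q = "\<lambda>n. density M (\<lambda>x. ennreal (q n x))"
    have bp: "\<bar>measure ?P A - p x * m\<bar> \<le> \<epsilon> * m"
      unfolding m_def using A \<F> \<epsilon> nn x by (intro density_average) auto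
    have bq: "\<bar>measure (?Q n) A - q n x * m\<bar> \<le> \<epsilon> * m" for n
      unfolding m_def using A \<F> \<epsilon> nn x by (intro density_average) auto
    obtain N where N: "\<And>n. n \<ge> N \<Longrightarrow> \<bar>measure (?Q n) A - measure ?P A\<bar> < \<epsilon> * m"
      using metric_LIMSEQ_D[OF conv[OF A(1)], of "\<epsilon> * m"] \<epsilon> m by (auto simp: dist_real_def)
    have "dist (q n x) (p x) < r" if "n \<ge> N" for n
    proof -
      have "\<bar>q n x * m - p x * m\<bar> < 3 * (\<epsilon> * m)" using N[OF that] bp bq[of n] by linarith
      moreover have "\<bar>q n x * m - p x * m\<bar> = \<bar>q n x - p x\<bar> * m"
        using m by (simp add: abs_mult flip: left_diff_distrib)
      ultimately have "\<bar>q n x - p x\<bar> * m < 3 * \<epsilon> * m" by simp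
      then have "\<bar>q n x - p x\<bar> < 3 * \<epsilon>" using m by simp
      then show ?thesis using r by (simp add: dist_real_def \<epsilon>_def)
    qed
    then show "\<exists>N. \<forall>n\<ge>N. dist (q n x) (p x) < r" by blast
  qed
  ultimately show ?thesis by auto
qed

section \<open>Countable families of small sets with finite measure\<close>

text \<open>Balls of radius \<open>1 / Suc k\<close> around a countable dense set, of which only
  those with finite measure are kept. Near every point sufficiently small balls lie in a
  neighbourhood of finite measure, so enough of them survive.\<close>

lemma countable_small_sets:
  assumes sep: "separable_space (mtopology_of m)" and lf: "locally_finite_on m N"
  shows "\<exists>\<B>. countable \<B> \<and> (\<forall>B\<in>\<B>. B \<in> sets N \<and> emeasure N B < \<infinity>) \<and>
    (\<forall>x\<in>mspace m. \<forall>\<epsilon>>0. \<exists>B\<in>\<B>. x \<in> B \<and> (\<forall>y\<in>B. mdist m x y < \<epsilon>))"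
proof -
  interpret Metric_space "mspace m" "mdist m" by (rule Metric_space_mspace_mdist)
  have top: "mtopology_of m = mtopology" by (simp add: mtopology_of_def)
  obtain S where S: "countable S" "S \<subseteq> mspace m" "mtopology closure_of S = mspace m"
    using sep by (auto simp: separable_space_def top)
  define \<B> where "\<B> = {B \<in> (\<lambda>(d, k). mball d (1 / real (Suc k))) ` (S \<times> UNIV). emeasure N B < \<infinity>}"
  show ?thesis
  proof (intro exI[of _ \<B>] conjI ballI allI impI)
    show "countable \<B>" unfolding \<B>_def using S(1) by (intro countable_Collect countable_image) auto
    have sub: "{U. openin mtopology U} \<subseteq> Pow (mspace m)"
      using openin_subset by fastforce
    have opN: "U \<in> sets N" if "openin mtopology U" for U
    proof -
      have "U \<in> sets (borel_of_metric m)"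
        using that sub by (simp add: borel_of_metric_def top sets_measure_of)
      then show ?thesis using lf by (simp add: locally_finite_on_def)
    qed
    then show "B \<in> sets N" if "B \<in> \<B>" for B using that by (auto simp: \<B>_def)
    show "emeasure N B < \<infinity>" if "B \<in> \<B>" for B using that by (auto simp: \<B>_def)
    fix x and \<epsilon> :: real assume x: "x \<in> mspace m" and \<epsilon>: "0 < \<epsilon>"
    obtain U where U: "openin mtopology U" "x \<in> U" "emeasure N U < \<infinity>"
      using lf x by (auto simp: locally_finite_on_def top)
    obtain r where r: "r > 0" "mball x r \<subseteq> U" using U by (auto simp: openin_mtopology)
    \<comment> \<open>Two points of one ball are less than twice its radius apart. Half of
      \<open>min r \<epsilon>\<close> therefore makes the ball both fit into \<open>U\<close> and
      stay within \<open>\<epsilon>\<close> of \<open>x\<close>.\<close>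
    obtain k where k: "1 / real (Suc k) < min r \<epsilon> / 2"
      using nat_approx_posE[of "min r \<epsilon> / 2"] r \<epsilon> by auto
    have "x \<in> mtopology closure_of S" using x S by simp
    then have "\<forall>r>0. \<exists>d\<in>S. d \<in> mball x r"
      by (simp add: metric_closure_of del: in_mball)
    then obtain d where d: "d \<in> S" "d \<in> mball x (1 / real (Suc k))"
      by (meson of_nat_0_less_iff zero_less_Suc zero_less_divide_1_iff)
    define B where "B = mball d (1 / real (Suc k))"
    have near: "mdist m x y < min r \<epsilon>" "y \<in> mspace m" if "y \<in> B" for y
    proof -
      have y: "y \<in> mspace m" "mdist m d y < 1 / real (Suc k)" using that by (auto simp: B_def)
      have "mdist m x y \<le> mdist m x d + mdist m d y" using x y d S by (intro triangle) auto
      then show "mdist m x y < min r \<epsilon>" using y d k by (auto simp del: of_nat_Suc)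
      show "y \<in> mspace m" by fact
    qed
    have "B \<subseteq> U" using near r x by fastforce
    then have "emeasure N B \<le> emeasure N U" using U opN by (intro emeasure_mono) auto
    then have "B \<in> \<B>" using U(3) d(1) by (auto simp: \<B>_def B_def)
    moreover have "x \<in> B" using x d S by (auto simp: B_def commute)
    ultimately show "\<exists>B\<in>\<B>. x \<in> B \<and> (\<forall>y\<in>B. mdist m x y < \<epsilon>)" 
      using near(1) by (intro bexI[of _ B] conjI ballI) auto
  qed
qed

lemma space_borel_of_metric [simp]: "space (borel_of_metric m) = mspace m"
  unfolding borel_of_metric_def
  using openin_subset[of "mtopology_of m"] by (intro space_measure_of) auto

lemma space_prod_space: "space (prod_space X A) = PiE A (\<lambda>v. mspace (X v))"
  by (simp add: prod_space_def space_PiM)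

text \<open>The small sets taken with distance bound 1 already cover the space. Sigma-finiteness is
  what the product measures and Fubini's theorem rest on.\<close>

lemma locally_finite_sigma_finite:
  assumes sep: "separable_space (mtopology_of m)" and lf: "locally_finite_on m N"
  shows "sigma_finite_measure N"
proof -
  obtain \<B> where \<B>: "countable \<B>" "\<forall>B\<in>\<B>. B \<in> sets N \<and> emeasure N B < \<infinity>"
    "\<forall>x\<in>mspace m. \<forall>\<epsilon>>0. \<exists>B\<in>\<B>. x \<in> B \<and> (\<forall>y\<in>B. mdist m x y < \<epsilon>)"
    using countable_small_sets[OF assms] by (elim exE conjE)
  have sp: "space N = mspace m"
    using lf sets_eq_imp_space_eq[of N "borel_of_metric m"] by (simp add: locally_finite_on_def)
  have "\<Union>\<B> = space N"
  proof
    show "\<Union>\<B> \<subseteq> space N" using \<B>(2) sets.sets_into_space by blast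
    show "space N \<subseteq> \<Union>\<B>" 
    proof
      fix x assume "x \<in> space N"
      then have "\<exists>B\<in>\<B>. x \<in> B \<and> (\<forall>y\<in>B. mdist m x y < 1)"
        using \<B>(3) sp zero_less_one by blast
      then show "x \<in> \<Union>\<B>" by blast
    qed
  qed
  then show ?thesis
    using \<B> by (intro sigma_finite_measure.intro exI[of _ \<B>]) (auto simp: less_top)
qed

section \<open>Joint densities of Bayesian networks\<close>

locale eqb_model =
  fixes V :: "'v set" and X :: "'v \<Rightarrow> 'a metric" and K :: real and \<omega> :: "real \<Rightarrow> real"
    and \<mu> :: "'v \<Rightarrow> 'a measure"
  assumes finite_V: "finite V"
    and separable: "\<And>v. v \<in> V \<Longrightarrow> separable_space (mtopology_of (X v))"
    and K_pos: "K > 0"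
    and modulus: "modulus_of_continuity \<omega>"
    and locally_finite: "\<And>v. v \<in> V \<Longrightarrow> locally_finite_on (X v) (\<mu> v)"
begin

text \<open>A sigma-finite measure is needed at every index, also outside \<open>V\<close>.\<close>

definition \<nu> :: "'v \<Rightarrow> 'a measure" where
  "\<nu> v = (if v \<in> V then \<mu> v else count_space {})"

sublocale product_sigma_finite \<nu>
proof (rule product_sigma_finite.intro)
  fix v show "sigma_finite_measure (\<nu> v)"
    using locally_finite_sigma_finite[OF separable locally_finite, of v]
    by (cases "v \<in> V") (simp_all add: \<nu>_def sigma_finite_measure_count_space_countable)
qed

lemma sets_\<nu>: "v \<in> V \<Longrightarrow> sets (\<nu> v) = sets (borel_of_metric (X v))"
  using locally_finite by (simp add: \<nu>_def locally_finite_on_def)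

lemma space_\<nu>: "v \<in> V \<Longrightarrow> space (\<nu> v) = mspace (X v)"
  using sets_eq_imp_space_eq[OF sets_\<nu>] by simp

lemma sets_PiM_\<nu>: "S \<subseteq> V \<Longrightarrow> sets (PiM S \<nu>) = sets (prod_space X S)"
  unfolding prod_space_def by (intro sets_PiM_cong refl sets_\<nu>) auto

lemma space_PiM_\<nu>: "S \<subseteq> V \<Longrightarrow> space (PiM S \<nu>) = space (prod_space X S)"
  by (intro sets_eq_imp_space_eq sets_PiM_\<nu>)

text \<open>Induction on the list, one application of Fubini's theorem per vertex. The head has no
  child in the tail, so the tail is again closed under parents and its factors do not see the new
  coordinate. Both conclusions are proved together because composing with the next kernel requires
  the measure built so far to be a probability measure.\<close>

lemma kernel_product_density:
  assumes net: "bayesian_network X V G m"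
    and p: "\<And>v. v \<in> V \<Longrightarrow> cond_density X \<mu> G v (m v) (p v)"
    and vs: "distinct vs" "set vs \<subseteq> V" "sorted_wrt (\<lambda>v w. (v, w) \<notin> G) vs"
      "\<And>v. v \<in> set vs \<Longrightarrow> parents G v \<subseteq> set vs" "\<And>v. (v, v) \<notin> G"
  shows "kernel_product X G m vs \<in> space (prob_algebra (prod_space X (set vs)))"
    and "kernel_product X G m vs =
      density (PiM (set vs) \<nu>) (\<lambda>x. \<Prod>v\<in>set vs. ennreal (p v (x v, restrict x (parents G v))))"
proof -
  have "kernel_product X G m vs \<in> space (prob_algebra (prod_space X (set vs))) \<and>
    kernel_product X G m vs =
      density (PiM (set vs) \<nu>) (\<lambda>x. \<Prod>v\<in>set vs. ennreal (p v (x v, restrict x (parents G v))))"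
    using vs
  proof (induction vs)
    case Nil
    \<comment> \<open>The product measure over no coordinates is the point mass at the only
      extensional function on the empty set; the empty product of densities is 1.\<close>
    have "return (prod_space X {}) (\<lambda>_. undefined) = (PiM {} \<nu> :: ('v \<Rightarrow> 'a) measure)"
    proof (rule measure_eqI)
      show s: "sets (return (prod_space X {}) (\<lambda>_. undefined)) = sets (PiM {} \<nu>)"
        by (simp add: sets_PiM_\<nu>)
      fix A assume "A \<in> sets (return (prod_space X {}) (\<lambda>_. undefined :: 'a))"
      then have "A = {} \<or> A = {\<lambda>_. undefined}"
        unfolding s by (auto simp: sets_PiM_empty)
      then show "emeasure (return (prod_space X {}) (\<lambda>_. undefined)) A = emeasure (PiM {} \<nu>) A"
        by (auto simp: prod_space_def sets_PiM_empty)
    qed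
    moreover have "return (prod_space X {}) (\<lambda>_. undefined) \<in> space (prob_algebra (prod_space X {}))"
      by (auto simp: space_prob_algebra space_prod_space intro!: prob_space_return)
    ultimately show ?case by (simp add: density_1)
  next
    case (Cons v vs)
    define S where "S = set vs"
    have v: "v \<in> V" "v \<notin> S" and S: "S \<subseteq> V" "finite S" and insV: "insert v S \<subseteq> V"
      using Cons.prems by (auto simp: S_def)
    have pS: "parents G u \<subseteq> S" if "u \<in> S" for u
    proof -
      have "parents G u \<subseteq> insert v S" using Cons.prems(4)[of u] that by (auto simp: S_def)
      moreover have "v \<notin> parents G u" using Cons.prems(3) that by (auto simp: parents_def S_def)
      ultimately show ?thesis by blast
    qed
    have pv: "parents G v \<subseteq> S"
      using Cons.prems(4)[of v] Cons.prems(5)[of v] by (auto simp: S_def parents_def)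
    define N where "N = kernel_product X G m vs"
    define r where "r S x = (\<Prod>v\<in>S. ennreal (p v (x v, restrict x (parents G v))))"
      for S and x :: "'v \<Rightarrow> 'a"
    have "N \<in> space (prob_algebra (prod_space X (set vs))) \<and> N = density (PiM (set vs) \<nu>) (r (set vs))"
      unfolding N_def r_def
    proof (rule Cons.IH)
      show "distinct vs" "set vs \<subseteq> V" "sorted_wrt (\<lambda>v w. (v, w) \<notin> G) vs" using Cons.prems by auto
      show "parents G u \<subseteq> set vs" if "u \<in> set vs" for u using pS that by (simp add: S_def)
      show "(u, u) \<notin> G" for u by (rule Cons.prems)
    qed
    then have N: "N \<in> space (prob_algebra (prod_space X S))" "N = density (PiM S \<nu>) (r S)"
      unfolding S_def by (rule conjunct1, rule conjunct2)
    define B where "B x = distr (m v (restrict x (parents G v))) (prod_space X (insert v S)) (\<lambda>a. x(v := a))"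
      for x
    have mv: "m v \<in> prod_space X (parents G v) \<rightarrow>\<^sub>M prob_algebra (borel_of_metric (X v))"
      using net v by (auto simp: bayesian_network_def)
    have restr: "(\<lambda>x. restrict x (parents G u)) \<in> prod_space X T \<rightarrow>\<^sub>M prod_space X (parents G u)"
      if "parents G u \<subseteq> T" for u T
      unfolding prod_space_def by (rule measurable_restrict_subset[OF that])
    have upd: "(\<lambda>(x, a). x(v := a)) \<in> prod_space X S \<Otimes>\<^sub>M borel_of_metric (X v) \<rightarrow>\<^sub>M prod_space X (insert v S)"
      unfolding prod_space_def by (rule measurable_add_dim)
    have B: "B \<in> prod_space X S \<rightarrow>\<^sub>M prob_algebra (prod_space X (insert v S))"
      unfolding B_def
      by (rule measurable_distr_prob_space2[OF measurable_compose[OF restr[OF pv] mv] upd])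
    have pm: "(\<lambda>x. p u (x u, restrict x (parents G u))) \<in> borel_measurable (prod_space X T)"
      if "u \<in> T" "parents G u \<subseteq> T" "T \<subseteq> V" for u T
    proof (rule measurable_compose[OF measurable_Pair])
      show "p u \<in> borel_measurable (borel_of_metric (X u) \<Otimes>\<^sub>M prod_space X (parents G u))"
        using p[of u] that by (auto simp: cond_density_def)
      show "(\<lambda>x. x u) \<in> prod_space X T \<rightarrow>\<^sub>M borel_of_metric (X u)"
        unfolding prod_space_def using that by (intro measurable_component_singleton)
      show "(\<lambda>x. restrict x (parents G u)) \<in> prod_space X T \<rightarrow>\<^sub>M prod_space X (parents G u)"
        by (rule restr) fact
    qed
    have rm: "r S \<in> borel_measurable (prod_space X S)"
      unfolding r_def using pS S by (intro borel_measurable_prod_ennreal measurable_compose[OF pm]) auto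
    have rm': "r (insert v S) \<in> borel_measurable (prod_space X (insert v S))"
      unfolding r_def using pS pv insV
      by (intro borel_measurable_prod_ennreal measurable_compose[OF pm]) auto
    have NB: "kernel_product X G m (v # vs) = N \<bind> B"
      by (simp add: N_def B_def[abs_def] S_def)
    have 1: "N \<bind> B \<in> space (prob_algebra (prod_space X (insert v S)))"
      using prob_space_bind'[OF N(1) B] sets_bind'[OF N(1) B] by (simp add: space_prob_algebra)
    have 2: "N \<bind> B = density (PiM (insert v S) \<nu>) (r (insert v S))"
    proof (rule measure_eqI)
      show "sets (N \<bind> B) = sets (density (PiM (insert v S) \<nu>) (r (insert v S)))"
        using sets_bind'[OF N(1) B] by (simp add: sets_PiM_\<nu>[OF insV])
      fix A assume "A \<in> sets (N \<bind> B)"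
      then have A: "A \<in> sets (prod_space X (insert v S))" using sets_bind'[OF N(1) B] by simp
      have cong: "borel_measurable (prod_space X S) = borel_measurable (PiM S \<nu>)"
        "borel_measurable (prod_space X (insert v S)) = borel_measurable (PiM (insert v S) \<nu>)"
        by (auto intro!: measurable_cong_sets simp: sets_PiM_\<nu>[OF S(1)] sets_PiM_\<nu>[OF insV])
      have BA: "(\<lambda>x. emeasure (B x) A) \<in> borel_measurable (PiM S \<nu>)"
        unfolding cong(1)[symmetric]
        by (rule measurable_compose[OF measurable_prob_algebraD[OF B] measurable_emeasure_subprob_algebra[OF A]])
      \<comment> \<open>The kernel at a fixed \<open>x\<close> is an integral over the new
        coordinate alone, so the factor \<open>r S x\<close> moves inside as a constant.\<close>
      have step: "r S x * emeasure (B x) A =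
          (\<integral>\<^sup>+a. r (insert v S) (x(v := a)) * indicator A (x(v := a)) \<partial>\<nu> v)"
        if x: "x \<in> space (PiM S \<nu>)" for x
      proof -
        let ?y = "restrict x (parents G v)"
        have y: "?y \<in> space (prod_space X (parents G v))"
          using measurable_space[OF restr[OF pv]] x by (simp add: space_PiM_\<nu>[OF S(1)])
        have k: "m v ?y = density (\<nu> v) (\<lambda>a. ennreal (p v (a, ?y)))"
          using p[OF v(1)] y v by (auto simp: cond_density_def \<nu>_def)
        have mp: "(\<lambda>a. ennreal (p v (a, ?y))) \<in> borel_measurable (\<nu> v)"
        proof -
          have "(\<lambda>a. p v (a, ?y)) \<in> borel_measurable (borel_of_metric (X v))"
            using p[OF v(1)] unfolding cond_density_def
            by (intro measurable_compose[OF measurable_Pair2'[OF y]]) simp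
          then show ?thesis by (simp add: measurable_cong_sets[OF sets_\<nu>[OF v(1)] refl])
        qed
        have mu: "(\<lambda>a. x(v := a)) \<in> \<nu> v \<rightarrow>\<^sub>M prod_space X (insert v S)"
        proof -
          have "(\<lambda>a. x(v := a)) \<in> borel_of_metric (X v) \<rightarrow>\<^sub>M prod_space X (insert v S)"
            using measurable_compose[OF measurable_Pair1' upd, of x] x
            by (simp add: space_PiM_\<nu>[OF S(1)])
          then show ?thesis by (simp add: measurable_cong_sets[OF sets_\<nu>[OF v(1)] refl])
        qed
        have mi: "(\<lambda>a. indicator A (x(v := a)) :: ennreal) \<in> borel_measurable (\<nu> v)"
          using A by (intro measurable_compose[OF mu]) auto
        have "emeasure (B x) A = (\<integral>\<^sup>+z. indicator A z \<partial>B x)"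
          using A by (simp add: B_def)
        also have "\<dots> = (\<integral>\<^sup>+a. indicator A (x(v := a)) \<partial>m v ?y)"
          unfolding B_def using A mu by (intro nn_integral_distr) (auto simp: k)
        also have "\<dots> = (\<integral>\<^sup>+a. ennreal (p v (a, ?y)) * indicator A (x(v := a)) \<partial>\<nu> v)"
          unfolding k by (rule nn_integral_density[OF mp mi])
        finally have "r S x * emeasure (B x) A =
            (\<integral>\<^sup>+a. r S x * (ennreal (p v (a, ?y)) * indicator A (x(v := a))) \<partial>\<nu> v)"
          using mp mi by (subst nn_integral_cmult) auto
        also have "\<dots> = (\<integral>\<^sup>+a. r (insert v S) (x(v := a)) * indicator A (x(v := a)) \<partial>\<nu> v)"
        proof (intro nn_integral_cong)
          fix a
          \<comment> \<open>No vertex of \<open>insert v S\<close> has \<open>v\<close> as a parent,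
            so changing coordinate \<open>v\<close> affects only the first argument of the factor of
            \<open>v\<close>.\<close>
          have "restrict (x(v := a)) (parents G u) = restrict x (parents G u)" if "u \<in> insert v S" for u
            using that pS pv v(2) by (auto simp: fun_eq_iff restrict_def)
          then have "r (insert v S) (x(v := a)) = ennreal (p v (a, ?y)) * r S x"
            using v(2) S(2) unfolding r_def by (auto intro!: prod.cong arg_cong2[where f = "(*)"])
          then show "r S x * (ennreal (p v (a, ?y)) * indicator A (x(v := a))) =
              r (insert v S) (x(v := a)) * indicator A (x(v := a))"
            by (simp add: mult_ac)
        qed
        finally show ?thesis .
      qed
      have "emeasure (N \<bind> B) A = (\<integral>\<^sup>+x. emeasure (B x) A \<partial>N)"
        by (rule emeasure_bind_prob_algebra[OF N(1) B A])
      also have "\<dots> = (\<integral>\<^sup>+x. r S x * emeasure (B x) A \<partial>PiM S \<nu>)"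
        unfolding N(2) using rm BA by (intro nn_integral_density) (auto simp: cong)
      also have "\<dots> = (\<integral>\<^sup>+x. \<integral>\<^sup>+a. r (insert v S) (x(v := a)) * indicator A (x(v := a)) \<partial>\<nu> v \<partial>PiM S \<nu>)"
        by (intro nn_integral_cong step)
      also have "\<dots> = (\<integral>\<^sup>+z. r (insert v S) z * indicator A z \<partial>PiM (insert v S) \<nu>)"
      proof (rule product_nn_integral_insert[symmetric])
        have [measurable]: "r (insert v S) \<in> borel_measurable (PiM (insert v S) \<nu>)"
          "A \<in> sets (PiM (insert v S) \<nu>)"
          using rm' A by (simp_all add: cong sets_PiM_\<nu>[OF insV])
        show "(\<lambda>z. r (insert v S) z * indicator A z) \<in> borel_measurable (PiM (insert v S) \<nu>)"
          by measurable
      qed (use S v in auto)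
      also have "\<dots> = emeasure (density (PiM (insert v S) \<nu>) (r (insert v S))) A"
        using rm' A unfolding cong by (intro emeasure_density[symmetric]) (auto simp: sets_PiM_\<nu>[OF insV])
      finally show "emeasure (N \<bind> B) A = emeasure (density (PiM (insert v S) \<nu>) (r (insert v S))) A" .
    qed
    show ?case using 1 2 unfolding NB S_def list.set(2) r_def[abs_def] by (rule conjI)
  qed
  then show "kernel_product X G m vs \<in> space (prob_algebra (prod_space X (set vs)))"
    and "kernel_product X G m vs =
      density (PiM (set vs) \<nu>) (\<lambda>x. \<Prod>v\<in>set vs. ennreal (p v (x v, restrict x (parents G v))))"
    by auto
qed

section \<open>Uniform equicontinuity of the joint densities\<close>

text \<open>Euclidean distances are at most sums of coordinate distances: one summand for
  \<open>v\<close> and at most \<open>card V\<close> for its parents, whence the factor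
  \<open>1 + card V\<close>. Strictness comes from the summand of \<open>v\<close>, as there may be
  no parents. The bound is the same for every parent set.\<close>

lemma kernel_dist_less:
  assumes P: "finite P" "P \<subseteq> V" and v: "v \<in> V" and \<delta>: "0 < \<delta>"
    and d: "\<And>w. w \<in> V \<Longrightarrow> (1 + real (card V)) * mdist (X w) (x w) (y w) < \<delta>"
  shows "prod_dist (mdist (X v)) (prod_mdist X P) (x v, restrict x P) (y v, restrict y P) < \<delta>"
    and "0 \<le> prod_dist (mdist (X v)) (prod_mdist X P) (x v, restrict x P) (y v, restrict y P)"
proof -
  let ?d = "\<lambda>w. mdist (X w) (x w) (y w)"
  define \<eta> where "\<eta> = \<delta> / (1 + real (card V))"
  have \<eta>: "?d w < \<eta>" if "w \<in> V" for w
    using d[OF that] by (simp add: \<eta>_def field_simps)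
  have "prod_mdist X P (restrict x P) (restrict y P) = L2_set ?d P"
    unfolding prod_mdist_def L2_set_def by (intro arg_cong[where f = sqrt] sum.cong) auto
  then have "prod_dist (mdist (X v)) (prod_mdist X P) (x v, restrict x P) (y v, restrict y P) =
      sqrt ((?d v)\<^sup>2 + (L2_set ?d P)\<^sup>2)"
    by (simp add: prod_dist_def)
  also have "\<dots> \<le> ?d v + L2_set ?d P"
    by (intro sqrt_sum_squares_le_sum) (auto simp: L2_set_nonneg)
  also have "L2_set ?d P \<le> sum ?d P" by (rule L2_set_le_sum) simp
  also have "sum ?d P \<le> card P * \<eta>"
    using \<eta> P by (intro sum_bounded_above) (auto intro: less_imp_le)
  also have "\<dots> \<le> card V * \<eta>"
    using card_mono[OF finite_V P(2)] \<delta> by (intro mult_right_mono) (auto simp: \<eta>_def)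
  finally have "prod_dist (mdist (X v)) (prod_mdist X P) (x v, restrict x P) (y v, restrict y P)
      < \<eta> + card V * \<eta>"
    using \<eta>[OF v] by simp
  also have "\<dots> = (1 + real (card V)) * \<eta>" by (simp add: distrib_right)
  also have "\<dots> = \<delta>" by (simp add: \<eta>_def add_nonneg_eq_0_iff)
  finally show "prod_dist (mdist (X v)) (prod_mdist X P) (x v, restrict x P) (y v, restrict y P) < \<delta>" .
  show "0 \<le> prod_dist (mdist (X v)) (prod_mdist X P) (x v, restrict x P) (y v, restrict y P)"
    by (simp add: prod_dist_def)
qed

text \<open>The bound depends on \<open>\<omega>\<close>, \<open>K\<close> and \<open>V\<close> only, which makes the joint densities
  of all networks in the model uniformly equicontinuous.\<close>

definition equicontinuous_density :: "(('v \<Rightarrow> 'a) \<Rightarrow> real) \<Rightarrow> bool" where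
  "equicontinuous_density q \<longleftrightarrow> (\<forall>\<delta> \<epsilon>. 0 < \<delta> \<longrightarrow> (\<forall>t. 0 \<le> t \<longrightarrow> t < \<delta> \<longrightarrow> \<omega> t \<le> \<epsilon>) \<longrightarrow>
    (\<forall>x\<in>space (PiM V \<nu>). \<forall>y\<in>space (PiM V \<nu>).
      (\<forall>w\<in>V. (1 + real (card V)) * mdist (X w) (x w) (y w) < \<delta>) \<longrightarrow>
      \<bar>q x - q y\<bar> \<le> K ^ card V * (card V * (\<epsilon> / K))))"

text \<open>The joint density is a product of conditional densities with values between 0 and
  \<open>K\<close>, each oscillating by at most \<epsilon>. The graph enters only through the parent
  sets, and closeness in all coordinates controls the distance for each of them.\<close>

lemma obs_dist_density:
  assumes Gm: "(G, m) \<in> BN_eqb_all X V K \<omega> \<mu>"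
  shows "\<exists>q. q \<in> borel_measurable (PiM V \<nu>) \<and> (\<forall>x\<in>space (PiM V \<nu>). 0 \<le> q x) \<and>
    obs_dist X V G m = density (PiM V \<nu>) (\<lambda>x. ennreal (q x)) \<and> prob_space (obs_dist X V G m) \<and>
    equicontinuous_density q"
proof -
  have G: "dag V G" and m: "bayesian_network X V G m"
    and "\<forall>v\<in>V. \<exists>p. cond_density X \<mu> G v (m v) p \<and>
        (\<forall>z\<in>mspace (X v) \<times> space (prod_space X (parents G v)). p z \<le> K) \<and>
        admits_modulus (mspace (X v) \<times> space (prod_space X (parents G v)))
          (prod_dist (mdist (X v)) (prod_mdist X (parents G v))) \<omega> p"
    using Gm by (auto simp: BN_eqb_all_def BN_eqb_def)
  then obtain p where p: "\<And>v. v \<in> V \<Longrightarrow> cond_density X \<mu> G v (m v) (p v)"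
    and pK: "\<And>v z. v \<in> V \<Longrightarrow> z \<in> mspace (X v) \<times> space (prod_space X (parents G v)) \<Longrightarrow> p v z \<le> K"
    and p\<omega>: "\<And>v. v \<in> V \<Longrightarrow> admits_modulus (mspace (X v) \<times> space (prod_space X (parents G v)))
          (prod_dist (mdist (X v)) (prod_mdist X (parents G v))) \<omega> (p v)"
    by metis
  have par: "parents G v \<subseteq> V" for v using G by (auto simp: dag_def parents_def)
  have irr: "(v, v) \<notin> G" for v using G by (auto simp: dag_def acyclic_def)
  define vs where "vs = rev (SOME vs. topological_order V G vs)"
  have "topological_order V G (SOME vs. topological_order V G vs)"
    by (rule someI_ex[OF topological_order_exists[OF finite_V G]])
  then have vs: "distinct vs" "set vs = V" "sorted_wrt (\<lambda>v w. (v, w) \<notin> G) vs"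
    by (auto simp: vs_def topological_order_def sorted_wrt_rev)
  note kp = kernel_product_density[OF m p vs(1) _ vs(3) _ irr]
  have obs: "obs_dist X V G m = kernel_product X G m vs" by (simp add: obs_dist_def vs_def)
  have pt: "(x v, restrict x (parents G v)) \<in> mspace (X v) \<times> space (prod_space X (parents G v))"
    if "x \<in> space (PiM V \<nu>)" "v \<in> V" for x v
    using that par by (fastforce simp: space_PiM_\<nu> space_prod_space PiE_iff)
  define q where "q x = (\<Prod>v\<in>V. p v (x v, restrict x (parents G v)))" for x
  have p0: "0 \<le> p v (x v, restrict x (parents G v))" if "x \<in> space (PiM V \<nu>)" "v \<in> V" for x v
    using p[OF that(2)] pt[OF that] by (auto simp: cond_density_def)
  show ?thesis
  proof (intro exI[of _ q] conjI ballI)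
    have pm: "(\<lambda>x. p v (x v, restrict x (parents G v))) \<in> borel_measurable (PiM V \<nu>)" if "v \<in> V" for v
      unfolding measurable_cong_sets[OF sets_PiM_\<nu>[OF order_refl] refl]
    proof (rule measurable_compose[OF measurable_Pair])
      show "p v \<in> borel_measurable (borel_of_metric (X v) \<Otimes>\<^sub>M prod_space X (parents G v))"
        using p[OF that] by (auto simp: cond_density_def)
      show "(\<lambda>x. x v) \<in> prod_space X V \<rightarrow>\<^sub>M borel_of_metric (X v)"
        unfolding prod_space_def using that by (intro measurable_component_singleton)
      show "(\<lambda>x. restrict x (parents G v)) \<in> prod_space X V \<rightarrow>\<^sub>M prod_space X (parents G v)"
        unfolding prod_space_def by (rule measurable_restrict_subset[OF par])
    qed
    then show "q \<in> borel_measurable (PiM V \<nu>)"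
      unfolding q_def by (rule borel_measurable_prod)
    show "0 \<le> q x" if "x \<in> space (PiM V \<nu>)" for x
      unfolding q_def using that by (intro prod_nonneg p0) auto
    have "obs_dist X V G m =
        density (PiM V \<nu>) (\<lambda>x. \<Prod>v\<in>V. ennreal (p v (x v, restrict x (parents G v))))"
      using kp(2) par by (simp add: obs vs(2))
    also have "\<dots> = density (PiM V \<nu>) (\<lambda>x. ennreal (q x))"
      unfolding q_def
    proof (rule density_cong)
      show "AE x in PiM V \<nu>. (\<Prod>v\<in>V. ennreal (p v (x v, restrict x (parents G v)))) =
          ennreal (\<Prod>v\<in>V. p v (x v, restrict x (parents G v)))"
        by (intro AE_I2 prod_ennreal p0)
      show "(\<lambda>x. \<Prod>v\<in>V. ennreal (p v (x v, restrict x (parents G v)))) \<in> borel_measurable (PiM V \<nu>)"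
        using pm by (intro borel_measurable_prod_ennreal measurable_compose[OF pm]) auto
      show "(\<lambda>x. ennreal (\<Prod>v\<in>V. p v (x v, restrict x (parents G v)))) \<in> borel_measurable (PiM V \<nu>)"
        by (rule measurable_compose[OF borel_measurable_prod[OF pm] measurable_ennreal])
    qed
    finally show "obs_dist X V G m = density (PiM V \<nu>) (\<lambda>x. ennreal (q x))" .
    show "prob_space (obs_dist X V G m)"
      using kp(1) par by (simp add: obs vs(2) space_prob_algebra)
    show "equicontinuous_density q"
      unfolding equicontinuous_density_def
    proof (intro allI impI ballI)
      fix \<delta> \<epsilon> x y
      assume \<delta>: "0 < \<delta>" and \<epsilon>: "\<forall>t. 0 \<le> t \<longrightarrow> t < \<delta> \<longrightarrow> \<omega> t \<le> \<epsilon>"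
        and x: "x \<in> space (PiM V \<nu>)" and y: "y \<in> space (PiM V \<nu>)"
        and d: "\<forall>w\<in>V. (1 + real (card V)) * mdist (X w) (x w) (y w) < \<delta>"
      \<comment> \<open>Dividing by \<open>K\<close> brings the factors into the unit interval,
        where a difference of products is at most the sum of the differences of the factors. This is
        the origin of the constant \<open>K ^ card V * (card V * (\<epsilon> / K))\<close>.\<close>
      define z where "z x v = p v (x v, restrict x (parents G v)) / K" for x v
      have z1: "norm (z x v) \<le> 1" if "x \<in> space (PiM V \<nu>)" "v \<in> V" for x v
        using p0[OF that] pK[OF that(2) pt[OF that]] K_pos by (simp add: z_def)
      have qz: "q x = K ^ card V * (\<Prod>v\<in>V. z x v)" for x
        using K_pos by (simp add: q_def z_def prod_dividef)
      have "\<bar>q x - q y\<bar> = K ^ card V * \<bar>(\<Prod>v\<in>V. z x v) - (\<Prod>v\<in>V. z y v)\<bar>"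
        using K_pos by (simp add: qz abs_mult flip: right_diff_distrib)
      also have "\<bar>(\<Prod>v\<in>V. z x v) - (\<Prod>v\<in>V. z y v)\<bar> \<le> (\<Sum>v\<in>V. \<bar>z x v - z y v\<bar>)"
        using norm_prod_diff[of V "z x" "z y"] z1 x y by simp
      also have "\<dots> \<le> card V * (\<epsilon> / K)"
      proof (intro sum_bounded_above)
        fix v assume v: "v \<in> V"
        have "\<bar>p v (x v, restrict x (parents G v)) - p v (y v, restrict y (parents G v))\<bar>
          \<le> \<omega> (prod_dist (mdist (X v)) (prod_mdist X (parents G v))
              (x v, restrict x (parents G v)) (y v, restrict y (parents G v)))"
          using p\<omega>[OF v] pt[OF x v] pt[OF y v] by (auto simp: admits_modulus_def)
        also have "\<dots> \<le> \<epsilon>"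
          using kernel_dist_less[OF finite_subset[OF par finite_V] par v \<delta>] d \<epsilon> by blast
        finally show "\<bar>z x v - z y v\<bar> \<le> \<epsilon> / K"
          using K_pos by (simp add: z_def divide_right_mono flip: diff_divide_distrib)
      qed
      finally show "\<bar>q x - q y\<bar> \<le> K ^ card V * (card V * (\<epsilon> / K))"
        using K_pos by simp
    qed
  qed
qed

lemma modulus_small:
  assumes "0 < \<epsilon>"
  shows "\<exists>\<delta>>0. \<forall>t. 0 \<le> t \<longrightarrow> t < \<delta> \<longrightarrow> \<omega> t \<le> \<epsilon>"
proof -
  have "\<forall>\<^sub>F t in at_right 0. \<omega> t < \<epsilon>"
    using modulus assms by (intro order_tendstoD(2)[of \<omega> 0]) (auto simp: modulus_of_continuity_def)
  then obtain \<delta> where \<delta>: "0 < \<delta>" "\<And>t. 0 < t \<Longrightarrow> t < \<delta> \<Longrightarrow> \<omega> t < \<epsilon>"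
    by (auto simp: eventually_at_right_field)
  moreover have "\<omega> 0 \<le> \<epsilon>" using modulus assms by (simp add: modulus_of_continuity_def)
  ultimately have "\<omega> t \<le> \<epsilon>" if "0 \<le> t" "t < \<delta>" for t
    using that by (cases "t = 0") (auto intro: less_imp_le)
  with \<delta>(1) show ?thesis by blast
qed

section \<open>Small boxes, and total variation limits inside the model\<close>

text \<open>A box is a choice of one small set per coordinate. Finiteness of \<open>V\<close> makes
  the choices countable and the measure of a box a finite product of finite factors.\<close>

lemma countable_small_boxes:
  "\<exists>\<F>. countable \<F> \<and> (\<forall>A\<in>\<F>. A \<in> sets (PiM V \<nu>) \<and> emeasure (PiM V \<nu>) A < \<infinity>) \<and>
    (\<forall>x\<in>space (PiM V \<nu>). \<forall>\<epsilon>>0. \<exists>A\<in>\<F>. x \<in> A \<and> (\<forall>y\<in>A. \<forall>v\<in>V. mdist (X v) (x v) (y v) < \<epsilon>))"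
proof -
  have "\<exists>\<B>. countable \<B> \<and> (\<forall>B\<in>\<B>. B \<in> sets (\<nu> v) \<and> emeasure (\<nu> v) B < \<infinity>) \<and>
    (\<forall>x\<in>mspace (X v). \<forall>\<epsilon>>0. \<exists>B\<in>\<B>. x \<in> B \<and> (\<forall>y\<in>B. mdist (X v) x y < \<epsilon>))" if v: "v \<in> V" for v
  proof -
    have \<nu>: "\<nu> v = \<mu> v" using v by (simp add: \<nu>_def)
    show ?thesis
      unfolding \<nu> by (rule countable_small_sets[OF separable[OF v] locally_finite[OF v]])
  qed
  then have "\<forall>v\<in>V. \<exists>\<B>. countable \<B> \<and> (\<forall>B\<in>\<B>. B \<in> sets (\<nu> v) \<and> emeasure (\<nu> v) B < \<infinity>) \<and>
    (\<forall>x\<in>mspace (X v). \<forall>\<epsilon>>0. \<exists>B\<in>\<B>. x \<in> B \<and> (\<forall>y\<in>B. mdist (X v) x y < \<epsilon>))"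
    by (rule ballI)
  from bchoice[OF this] obtain \<B> where *: "\<forall>v\<in>V. countable (\<B> v) \<and>
    (\<forall>B\<in>\<B> v. B \<in> sets (\<nu> v) \<and> emeasure (\<nu> v) B < \<infinity>) \<and>
    (\<forall>x\<in>mspace (X v). \<forall>\<epsilon>>0. \<exists>B\<in>\<B> v. x \<in> B \<and> (\<forall>y\<in>B. mdist (X v) x y < \<epsilon>))"
    by (elim exE)
  have \<B>: "\<And>v. v \<in> V \<Longrightarrow> countable (\<B> v)"
    "\<And>v B. v \<in> V \<Longrightarrow> B \<in> \<B> v \<Longrightarrow> B \<in> sets (\<nu> v)"
    "\<And>v B. v \<in> V \<Longrightarrow> B \<in> \<B> v \<Longrightarrow> emeasure (\<nu> v) B < \<infinity>"
    "\<And>v x \<epsilon>. v \<in> V \<Longrightarrow> x \<in> mspace (X v) \<Longrightarrow> 0 < \<epsilon> \<Longrightarrow>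
      \<exists>B\<in>\<B> v. x \<in> B \<and> (\<forall>y\<in>B. mdist (X v) x y < \<epsilon>)"
    using * by blast+
  show ?thesis
  proof (intro exI[of _ "PiE V ` PiE V \<B>"] conjI ballI allI impI)
    show "countable (PiE V ` PiE V \<B>)"
      by (intro countable_image countable_PiE finite_V \<B>)
    show "A \<in> sets (PiM V \<nu>)" if "A \<in> PiE V ` PiE V \<B>" for A
      using that \<B>(2) finite_V by (auto intro!: sets_PiM_I_finite simp: PiE_iff)
    show "emeasure (PiM V \<nu>) A < \<infinity>" if A: "A \<in> PiE V ` PiE V \<B>" for A
    proof -
      obtain U where U: "A = PiE V U" "U \<in> PiE V \<B>" using A by auto
      have "emeasure (PiM V \<nu>) A = (\<Prod>v\<in>V. emeasure (\<nu> v) (U v))"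
        unfolding U(1) using U(2) \<B>(2) by (intro emeasure_PiM finite_V) (auto simp: PiE_iff)
      moreover have "emeasure (\<nu> v) (U v) \<noteq> \<top>" if "v \<in> V" for v
        using \<B>(3)[OF that] U(2) that by (auto simp: PiE_iff less_top)
      ultimately show ?thesis by (simp add: ennreal_prod_eq_top less_top[symmetric])
    qed
    fix x and \<epsilon> :: real assume x: "x \<in> space (PiM V \<nu>)" and \<epsilon>: "0 < \<epsilon>"
    have "\<forall>v\<in>V. \<exists>B. B \<in> \<B> v \<and> x v \<in> B \<and> (\<forall>y\<in>B. mdist (X v) (x v) y < \<epsilon>)"
    proof
      fix v assume v: "v \<in> V"
      have "x v \<in> mspace (X v)" using x v by (simp add: space_PiM_\<nu> space_prod_space PiE_iff)
      from \<B>(4)[OF v this \<epsilon>] show "\<exists>B. B \<in> \<B> v \<and> x v \<in> B \<and> (\<forall>y\<in>B. mdist (X v) (x v) y < \<epsilon>)"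
        by (simp add: Bex_def)
    qed
    from bchoice[OF this] obtain U where
      "\<forall>v\<in>V. U v \<in> \<B> v \<and> x v \<in> U v \<and> (\<forall>y\<in>U v. mdist (X v) (x v) y < \<epsilon>)"
      by (elim exE)
    then have U: "\<And>v. v \<in> V \<Longrightarrow> U v \<in> \<B> v" "\<And>v. v \<in> V \<Longrightarrow> x v \<in> U v"
      "\<And>v y. v \<in> V \<Longrightarrow> y \<in> U v \<Longrightarrow> mdist (X v) (x v) y < \<epsilon>"
      by simp_all
    \<comment> \<open>The chosen \<open>U\<close> is arbitrary outside \<open>V\<close>; its
      restriction represents the same box and belongs to the index set.\<close>
    have "PiE V U = PiE V (restrict U V)" by (intro PiE_cong) auto
    moreover have "restrict U V \<in> PiE V \<B>" using U(1) by auto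
    ultimately have "PiE V U \<in> PiE V ` PiE V \<B>" by (intro image_eqI)
    moreover have "x \<in> PiE V U" using U(2) x by (auto simp: space_PiM PiE_iff)
    moreover have "mdist (X v) (x v) (y v) < \<epsilon>" if "y \<in> PiE V U" "v \<in> V" for y v
      using U(3) that by (auto simp: PiE_iff)
    ultimately show "\<exists>A\<in>PiE V ` PiE V \<B>. x \<in> A \<and> (\<forall>y\<in>A. \<forall>v\<in>V. mdist (X v) (x v) (y v) < \<epsilon>)"
      by (intro bexI[of _ "PiE V U"] conjI ballI)
  qed
qed

text \<open>The family of boxes is fixed before any network, since the test has to be built from one
  family that serves all distributions and all graphs. Only \<open>\<delta>\<close> depends on the
  sequence.\<close>

lemma tv_limit:
  "\<exists>\<F>. countable \<F> \<and> \<F> \<subseteq> sets (prod_space X V) \<and>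
    (\<forall>G m Gn mn. (G, m) \<in> BN_eqb_all X V K \<omega> \<mu> \<longrightarrow>
      (\<forall>n. (Gn n, mn n) \<in> BN_eqb_all X V K \<omega> \<mu>) \<longrightarrow>
      (\<forall>A\<in>\<F>. (\<lambda>n::nat. measure (obs_dist X V (Gn n) (mn n)) A) \<longlonglongrightarrow> measure (obs_dist X V G m) A) \<longrightarrow>
      (\<exists>\<delta>. \<delta> \<longlonglongrightarrow> (0::real) \<and> (\<forall>n. \<forall>h\<in>borel_measurable (obs_dist X V G m). (\<forall>x. \<bar>h x\<bar> \<le> 1) \<longrightarrow>
        \<bar>(\<integral>x. h x \<partial>obs_dist X V G m) - (\<integral>x. h x \<partial>obs_dist X V (Gn n) (mn n))\<bar> \<le> \<delta> n)))"
proof -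
  obtain \<F> where 0: "countable \<F>" "\<forall>A\<in>\<F>. A \<in> sets (PiM V \<nu>) \<and> emeasure (PiM V \<nu>) A < \<infinity>"
    "\<forall>x\<in>space (PiM V \<nu>). \<forall>\<epsilon>>0. \<exists>A\<in>\<F>. x \<in> A \<and> (\<forall>y\<in>A. \<forall>v\<in>V. mdist (X v) (x v) (y v) < \<epsilon>)"
    using countable_small_boxes by (elim exE conjE)
  then have \<F>: "\<And>A. A \<in> \<F> \<Longrightarrow> A \<in> sets (PiM V \<nu>)"
    "\<And>A. A \<in> \<F> \<Longrightarrow> emeasure (PiM V \<nu>) A < \<infinity>"
    "\<And>x \<epsilon>. x \<in> space (PiM V \<nu>) \<Longrightarrow> 0 < \<epsilon> \<Longrightarrow>
      \<exists>A\<in>\<F>. x \<in> A \<and> (\<forall>y\<in>A. \<forall>v\<in>V. mdist (X v) (x v) (y v) < \<epsilon>)"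
    by simp_all
  show ?thesis
  proof (intro exI[of _ \<F>] conjI allI impI)
    show "countable \<F>" by (rule 0)
    show "\<F> \<subseteq> sets (prod_space X V)"
      using \<F>(1) sets_PiM_\<nu>[of V] by auto
    fix G m Gn mn
    assume Gm: "(G, m) \<in> BN_eqb_all X V K \<omega> \<mu>" and Gmn: "\<forall>n. (Gn n, mn n) \<in> BN_eqb_all X V K \<omega> \<mu>"
      and conv: "\<forall>A\<in>\<F>.
        (\<lambda>n::nat. measure (obs_dist X V (Gn n) (mn n)) A) \<longlonglongrightarrow> measure (obs_dist X V G m) A"
    obtain p where p: "p \<in> borel_measurable (PiM V \<nu>)" "\<And>x. x \<in> space (PiM V \<nu>) \<Longrightarrow> 0 \<le> p x"
      "obs_dist X V G m = density (PiM V \<nu>) (\<lambda>x. ennreal (p x))" "prob_space (obs_dist X V G m)" "equicontinuous_density p"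
      using obs_dist_density[OF Gm] by auto
    have "\<forall>n. \<exists>q. q \<in> borel_measurable (PiM V \<nu>) \<and> (\<forall>x\<in>space (PiM V \<nu>). 0 \<le> q x) \<and>
      obs_dist X V (Gn n) (mn n) = density (PiM V \<nu>) (\<lambda>x. ennreal (q x)) \<and>
      prob_space (obs_dist X V (Gn n) (mn n)) \<and> equicontinuous_density q"
      using obs_dist_density Gmn by simp
    from choice[OF this] obtain q where "\<forall>n. q n \<in> borel_measurable (PiM V \<nu>) \<and>
      (\<forall>x\<in>space (PiM V \<nu>). 0 \<le> q n x) \<and>
      obs_dist X V (Gn n) (mn n) = density (PiM V \<nu>) (\<lambda>x. ennreal (q n x)) \<and>
      prob_space (obs_dist X V (Gn n) (mn n)) \<and> equicontinuous_density (q n)"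
      by (elim exE)
    then have q: "\<And>n. q n \<in> borel_measurable (PiM V \<nu>)"
      "\<And>n x. x \<in> space (PiM V \<nu>) \<Longrightarrow> 0 \<le> q n x"
      "\<And>n. obs_dist X V (Gn n) (mn n) = density (PiM V \<nu>) (\<lambda>x. ennreal (q n x))"
      "\<And>n. prob_space (obs_dist X V (Gn n) (mn n))" "\<And>n. equicontinuous_density (q n)"
      by blast+
    have ae: "AE x in PiM V \<nu>. (\<lambda>n. q n x) \<longlonglongrightarrow> p x"
    proof (rule density_AE_limit[where \<F> = \<F>])
      fix x and \<epsilon> :: real assume x: "x \<in> space (PiM V \<nu>)" and \<epsilon>: "0 < \<epsilon>"
      \<comment> \<open>A bound \<epsilon>' on the modulus yields an oscillation of the joint
        density of at most \<open>c * \<epsilon>'\<close>. Using \<open>1 + card V\<close> rather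
        than \<open>card V\<close> keeps \<open>c\<close> positive when \<open>V\<close> is
        empty.\<close>
      define c where "c = K ^ card V * (1 + real (card V)) / K"
      define \<epsilon>' where "\<epsilon>' = \<epsilon> / c"
      have c: "0 < c" using K_pos by (simp add: c_def add_pos_nonneg)
      then have "0 < \<epsilon>'" using \<epsilon> by (simp add: \<epsilon>'_def)
      then obtain \<delta> where \<delta>: "0 < \<delta>" "\<And>t. 0 \<le> t \<Longrightarrow> t < \<delta> \<Longrightarrow> \<omega> t \<le> \<epsilon>'"
        using modulus_small by blast
      have "K ^ card V * (card V * (\<epsilon>' / K)) \<le> K ^ card V * ((1 + real (card V)) * (\<epsilon>' / K))"
        using K_pos \<open>0 < \<epsilon>'\<close> by (intro mult_left_mono mult_right_mono) auto
      also have "\<dots> = c * \<epsilon>'" by (simp add: c_def)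
      also have "\<dots> = \<epsilon>" using c by (simp add: \<epsilon>'_def)
      finally have le: "K ^ card V * (card V * (\<epsilon>' / K)) \<le> \<epsilon>" .
      obtain A where A: "A \<in> \<F>" "x \<in> A"
        "\<And>y v. y \<in> A \<Longrightarrow> v \<in> V \<Longrightarrow> mdist (X v) (x v) (y v) < \<delta> / (1 + real (card V))"
        using \<F>(3)[OF x, of "\<delta> / (1 + real (card V))"] \<delta>(1) by auto
      have close: "\<bar>f y - f x\<bar> \<le> \<epsilon>" if "equicontinuous_density f" "y \<in> A" for f y
      proof -
        have "y \<in> space (PiM V \<nu>)" using \<F>(1)[OF A(1)] that(2) sets.sets_into_space by blast
        moreover have "(1 + real (card V)) * mdist (X w) (x w) (y w) < \<delta>" if "w \<in> V" for w
          using A(3)[OF \<open>y \<in> A\<close> that] by (simp add: field_simps)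
        ultimately have "\<bar>f x - f y\<bar> \<le> K ^ card V * (card V * (\<epsilon>' / K))"
          using \<open>equicontinuous_density f\<close> \<delta> x unfolding equicontinuous_density_def by blast
        then show ?thesis using le by (simp add: abs_minus_commute)
      qed
      show "\<exists>A\<in>\<F>. x \<in> A \<and> (\<forall>y\<in>A. \<bar>p y - p x\<bar> \<le> \<epsilon> \<and> (\<forall>n. \<bar>q n y - q n x\<bar> \<le> \<epsilon>))"
        using A(1,2) close[OF p(5)] close[OF q(5)] by blast
    next
      fix A assume "A \<in> \<F>"
      then show "(\<lambda>n. measure (density (PiM V \<nu>) (\<lambda>x. ennreal (q n x))) A)
          \<longlonglongrightarrow> measure (density (PiM V \<nu>) (\<lambda>x. ennreal (p x))) A"
        using conv by (simp add: p(3) q(3))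
    qed (use p q 0(1) \<F>(1,2) in auto)
    show "\<exists>\<delta>. \<delta> \<longlonglongrightarrow> (0::real) \<and> (\<forall>n. \<forall>h\<in>borel_measurable (obs_dist X V G m). (\<forall>x. \<bar>h x\<bar> \<le> 1) \<longrightarrow>
        \<bar>(\<integral>x. h x \<partial>obs_dist X V G m) - (\<integral>x. h x \<partial>obs_dist X V (Gn n) (mn n))\<bar> \<le> \<delta> n)"
      using density_L1_limit[OF p(1) q(1) p(2) q(2) p(4)[unfolded p(3)] q(4)[unfolded q(3)] ae]
      unfolding p(3) q(3) Ball_def measurable_density_eq1 .
  qed
qed

end

section \<open>Testability of conditional independence\<close>

lemma restrict_measurable_prod_space:
  "A \<subseteq> V \<Longrightarrow> (\<lambda>x. restrict x A) \<in> prod_space X V \<rightarrow>\<^sub>M prod_space X A"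
  unfolding prod_space_def by (rule measurable_restrict_subset)

lemma subalgebra_sigma_of_proj:
  assumes "C \<subseteq> V" "sets P = sets (prod_space X V)"
  shows "subalgebra P (sigma_of_proj X V C)"
proof -
  have sp: "space P = space (prod_space X V)" by (rule sets_eq_imp_space_eq) fact
  have m: "(\<lambda>x. restrict x C) \<in> prod_space X V \<rightarrow>\<^sub>M prod_space X C"
    by (rule restrict_measurable_prod_space) fact
  have "sets (sigma_of_proj X V C) =
      {(\<lambda>x. restrict x C) -` E \<inter> space (prod_space X V) | E. E \<in> sets (prod_space X C)}"
    unfolding sigma_of_proj_def using measurable_space[OF m] by (intro sets_vimage_algebra2) auto
  then show ?thesis
    using measurable_sets[OF m] by (auto simp: subalgebra_def sp assms(2) sigma_of_proj_def)
qed

theorem mainTheorem9: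
  fixes V :: "'v set"
    and X :: "'v \<Rightarrow> 'a metric"
    and K :: real
    and \<omega> :: "real \<Rightarrow> real"
    and \<mu> :: "'v \<Rightarrow> 'a measure"
    and A B C :: "'v set"
    and PP H0 H1 :: "('v \<Rightarrow> 'a) measure set"
  assumes "finite V"
    and "\<And>v. v \<in> V \<Longrightarrow> mcomplete_of (X v)"
    and "\<And>v. v \<in> V \<Longrightarrow> separable_space (mtopology_of (X v))"
    and "\<And>v. v \<in> V \<Longrightarrow> \<exists>x\<in>mspace (X v). \<exists>y\<in>mspace (X v). x \<noteq> y"
    and "K > 0"
    and "modulus_of_continuity \<omega>"
    and "\<And>v. v \<in> V \<Longrightarrow> locally_finite_on (X v) (\<mu> v)"
    and "A \<subseteq> V" and "B \<subseteq> V" and "C \<subseteq> V"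
    and "PP = {obs_dist X V G m | G m. (G, m) \<in> BN_eqb_all X V K \<omega> \<mu>}"
    and "H0 = {P \<in> PP. cond_indep X V P A B C}"
    and "H1 = PP - H0"
  shows "consistently_testable (prod_space X V) PP (\<lambda>i. if i = 0 then H0 else H1)"
proof -
  interpret eqb_model V X K \<omega> \<mu>
    by (rule eqb_model.intro) (use assms in auto)
  obtain \<F> where \<F>: "countable \<F>" "\<F> \<subseteq> sets (prod_space X V)"
    and tv: "\<forall>G m Gn mn. (G, m) \<in> BN_eqb_all X V K \<omega> \<mu> \<longrightarrow>
      (\<forall>n. (Gn n, mn n) \<in> BN_eqb_all X V K \<omega> \<mu>) \<longrightarrow>
      (\<forall>A\<in>\<F>. (\<lambda>n::nat. measure (obs_dist X V (Gn n) (mn n)) A) \<longlonglongrightarrow> measure (obs_dist X V G m) A) \<longrightarrow>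
      (\<exists>\<delta>. \<delta> \<longlonglongrightarrow> (0::real) \<and> (\<forall>n. \<forall>h\<in>borel_measurable (obs_dist X V G m). (\<forall>x. \<bar>h x\<bar> \<le> 1) \<longrightarrow>
        \<bar>(\<integral>x. h x \<partial>obs_dist X V G m) - (\<integral>x. h x \<partial>obs_dist X V (Gn n) (mn n))\<bar> \<le> \<delta> n))"
    using tv_limit by (elim exE conjE)
  \<comment> \<open>\<open>from_nat_into\<close> enumerates nonempty sets only; adding the empty
    event ensures this and is harmless for the test.\<close>
  define F where "F = from_nat_into (insert {} \<F>)"
  have range_F: "range F = insert {} \<F>"
    unfolding F_def using \<F>(1) by (intro range_from_nat_into) auto
  have PP: "prob_space P" "sets P = sets (prod_space X V)" if P: "P \<in> PP" for P
  proof -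
    obtain G m where Gm: "P = obs_dist X V G m" "(G, m) \<in> BN_eqb_all X V K \<omega> \<mu>"
      using P assms(11) by blast
    show "prob_space P" using obs_dist_density[OF Gm(2)] Gm(1) by blast
    show "sets P = sets (prod_space X V)"
      using obs_dist_density[OF Gm(2)] Gm(1) sets_PiM_\<nu>[of V] by force
  qed
  have H0: "Q \<in> PP" "cond_indep X V Q A B C" if "Q \<in> H0" for Q using that assms(12) by auto
  have "consistently_testable (prod_space X V) PP (\<lambda>i. if i = 0 then H0 else PP - H0)"
  proof (rule consistently_testable_closed[OF PP])
    show "H0 \<subseteq> PP" using H0 by blast
    show "F j \<in> sets (prod_space X V)" for j
      using range_F \<F>(2) by (metis insertE rangeI sets.empty_sets subsetD)
    fix P Q
    assume P: "P \<in> PP" and Q: "\<And>n. Q n \<in> H0"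
      and conv: "\<And>j. (\<lambda>n. measure (Q n) (F j)) \<longlonglongrightarrow> measure P (F j)"
    obtain G m where Gm: "P = obs_dist X V G m" "(G, m) \<in> BN_eqb_all X V K \<omega> \<mu>"
      using P assms(11) by blast
    \<comment> \<open>Graph and kernels are chosen together as a pair, separately for each
      \<open>n\<close>, so the graphs along the sequence may differ.\<close>
    have "\<forall>n. \<exists>N. Q n = obs_dist X V (fst N) (snd N) \<and> N \<in> BN_eqb_all X V K \<omega> \<mu>"
      using H0(1)[OF Q] assms(11) by fastforce
    from choice[OF this] obtain N where
      N: "\<forall>n. Q n = obs_dist X V (fst (N n)) (snd (N n)) \<and> N n \<in> BN_eqb_all X V K \<omega> \<mu>"
      by (elim exE)
    then have N_BN: "\<forall>n. (fst (N n), snd (N n)) \<in> BN_eqb_all X V K \<omega> \<mu>"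
      and Q_eq: "Q n = obs_dist X V (fst (N n)) (snd (N n))" for n
      by simp_all
    have conv_\<F>: "\<forall>S\<in>\<F>. (\<lambda>n. measure (obs_dist X V (fst (N n)) (snd (N n))) S)
        \<longlonglongrightarrow> measure (obs_dist X V G m) S"
    proof
      fix S assume "S \<in> \<F>"
      then have "S \<in> range F" by (simp add: range_F)
      then obtain j where "S = F j" by (rule rangeE)
      then show "(\<lambda>n. measure (obs_dist X V (fst (N n)) (snd (N n))) S)
          \<longlonglongrightarrow> measure (obs_dist X V G m) S"
        using conv[of j] by (simp only: Q_eq Gm(1))
    qed
    have "\<exists>\<delta>. \<delta> \<longlonglongrightarrow> (0::real) \<and> (\<forall>n. \<forall>h\<in>borel_measurable P. (\<forall>x. \<bar>h x\<bar> \<le> 1) \<longrightarrow>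
        \<bar>(\<integral>x. h x \<partial>P) - (\<integral>x. h x \<partial>Q n)\<bar> \<le> \<delta> n)"
      unfolding Q_eq Gm(1)
      by (rule tv[THEN spec[of _ G], THEN spec[of _ m], THEN spec[of _ "\<lambda>n. fst (N n)"],
            THEN spec[of _ "\<lambda>n. snd (N n)"], THEN mp, THEN mp, THEN mp, OF Gm(2) N_BN conv_\<F>])
    then obtain \<delta> where \<delta>: "\<delta> \<longlonglongrightarrow> (0::real)"
      "\<forall>n. \<forall>h\<in>borel_measurable P. (\<forall>x. \<bar>h x\<bar> \<le> 1) \<longrightarrow>
        \<bar>(\<integral>x. h x \<partial>P) - (\<integral>x. h x \<partial>Q n)\<bar> \<le> \<delta> n"
      by (elim exE conjE)
    have sets: "sets (Q n) = sets P" for n using PP(2)[OF H0(1)[OF Q]] PP(2)[OF P] by simp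
    \<comment> \<open>The events in \<open>cond_indep\<close> are cut out of the space of the
      measure; equal spaces make them the same events for \<open>P\<close> and every
      \<open>Q n\<close>.\<close>
    have space: "space (Q n) = space P" for n by (rule sets_eq_imp_space_eq[OF sets])
    have "cond_indep X V P A B C"
      unfolding cond_indep_def cond_prob_def
    proof (intro ballI)
      fix EA EB assume EA: "EA \<in> sets (prod_space X A)" and EB: "EB \<in> sets (prod_space X B)"
      define E1 E2 where "E1 = {y \<in> space P. restrict y A \<in> EA}" and "E2 = {y \<in> space P. restrict y B \<in> EB}"
      have E12: "{y \<in> space P. restrict y A \<in> EA \<and> restrict y B \<in> EB} = E1 \<inter> E2"
        by (auto simp: E1_def E2_def)
      have E: "{y \<in> space P. restrict y D \<in> ED} \<in> sets P"
        if D: "D \<subseteq> V" "ED \<in> sets (prod_space X D)" for D ED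
      proof -
        have "(\<lambda>x. restrict x D) -` ED \<inter> space (prod_space X V) \<in> sets (prod_space X V)"
          by (rule measurable_sets[OF restrict_measurable_prod_space[OF D(1)] D(2)])
        also have "(\<lambda>x. restrict x D) -` ED \<inter> space (prod_space X V) = {y \<in> space P. restrict y D \<in> ED}"
          using sets_eq_imp_space_eq[OF PP(2)[OF P]] by auto
        finally show ?thesis by (simp add: PP(2)[OF P])
      qed
      have "AE x in P. real_cond_exp P (sigma_of_proj X V C) (indicator (E1 \<inter> E2)) x =
        real_cond_exp P (sigma_of_proj X V C) (indicator E1) x *
        real_cond_exp P (sigma_of_proj X V C) (indicator E2) x"
      proof (rule cond_prob_product_tv_limit[where Q = Q and \<delta> = \<delta>])
        show "prob_space P" by (rule PP(1)[OF P])
        show "prob_space (Q n)" for n by (rule PP(1)[OF H0(1)[OF Q]])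
        show "subalgebra P (sigma_of_proj X V C)"
          by (rule subalgebra_sigma_of_proj[OF assms(10) PP(2)[OF P]])
        show "E1 \<in> sets P" "E2 \<in> sets P" unfolding E1_def E2_def using E EA EB assms(8,9) by auto
        show "AE x in Q n. real_cond_exp (Q n) (sigma_of_proj X V C) (indicator (E1 \<inter> E2)) x =
          real_cond_exp (Q n) (sigma_of_proj X V C) (indicator E1) x *
          real_cond_exp (Q n) (sigma_of_proj X V C) (indicator E2) x" for n
          using bspec[OF bspec[OF H0(2)[OF Q[of n], unfolded cond_indep_def cond_prob_def] EA] EB]
          unfolding space E12 by (simp only: E1_def E2_def)
        show "sets (Q n) = sets P" for n by (rule sets)
        show "\<delta> \<longlonglongrightarrow> 0" by (rule \<delta>(1))
        show "\<bar>(\<integral>x. h x \<partial>P) - (\<integral>x. h x \<partial>Q n)\<bar> \<le> \<delta> n"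
          if "h \<in> borel_measurable P" "\<And>x. \<bar>h x\<bar> \<le> 1" for n and h :: "('v \<Rightarrow> 'a) \<Rightarrow> real"
          using \<delta>(2) that by simp
      qed
      then show "AE x in P. real_cond_exp P (sigma_of_proj X V C)
            (indicator {y \<in> space P. restrict y A \<in> EA \<and> restrict y B \<in> EB}) x =
          real_cond_exp P (sigma_of_proj X V C) (indicator {y \<in> space P. restrict y A \<in> EA}) x *
          real_cond_exp P (sigma_of_proj X V C) (indicator {y \<in> space P. restrict y B \<in> EB}) x"
        unfolding E12 E1_def E2_def .
    qed
    with P assms(12) show "P \<in> H0" by blast
  qed
  then show ?thesis unfolding assms(13) .
qed

end
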